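(* Let the setting, iteration, constants and Assumption A of the context hold. Suppose that $$2\omega(1-\lambda_{\max})(1-\eta)-\Omega^2L^2-\kappa^2-\tau^{-1}\Omega(2+M)(1+\eta)>0,\qquad \sum_{k=0}^\infty\lambda_k\le\lambda<\infty\ \text{ for some constant }\lambda,$$ and $$D_2:=2\omega(1-\lambda_{\max})(1-\eta)-\Omega^2L^2-\kappa^2>0.$$ Then the sequence $\{u_k\}_{k\ge1}$ produced by the exact-data IRSGD iteration converges almost surely to a (random) element $u^\dagger$ of $\mathcal D_{c(\rho)}(\hat u)$ in $U$, i.e. $$\lim_{k\to\infty}\mathbb E\big[\|u_k-u^\dagger\|^2\big]=0,\qquad u^\dagger\in\mathcal D_{c(\rho)}(\hat u)\ \text{almost surely}.$$
   Context: Setting. $U,Y_0,\dots,Y_{P-1}$ are Hilbert spaces, $Y^P=Y_0\times\cdots\times Y_{P-1}$ has the natural inner product. $F_i:\mathfrak D(F_i)\subset U\to Y_i$ are (nonlinear) Fréchet differentiable operators with derivative $F_i'(u)$ and adjoint $F_i'(u)^*$; $F=(F_0,\dots,F_{P-1})$. Exact data $y^\dagger=(y_0^\dagger,\dots,y_{P-1}^\dagger)\in Y^P$. $B_r(u)$ is the closed ball in $U$ of radius $r$ centred at $u$, and $\mathcal D_r(u):=\{v\in B_r(u):F(v)=y^\dagger\}$. Exact-data IRSGD iteration. With initial guess $u_0\in U$, $$u_{k+1}=u_k-\omega_kF_{i_k}'(u_k)^*(F_{i_k}(u_k)-y_{i_k}^\dagger)-\lambda_k(u_k-u_0),\quad k\ge0,$$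 where $0<\omega\le\omega_k\le\Omega$, $0\le\lambda_k\le\lambda_{\max}<\tfrac12$, and the indices $i_k$ are drawn independently and uniformly at random from $\{0,\dots,P-1\}$. $\mathbb E$ and "almost surely" refer to this randomness. Constants. $\rho>0$, $\kappa\in(0,1)$, $\tau>1$, and $\varrho>0$ is sufficiently small, meaning $(1-\lambda_{\max})^2<\frac1{1+\varrho}$. With $L,\eta$ from Assumption A, $$c(\rho)=\rho\lambda_{\max}\frac{(1-\lambda_{\max})+\sqrt{(1-\lambda_{\max})^2+\left(\frac1{1+\varrho}-(1-\lambda_{\max})^2\right)(1+\kappa^{-2}\Omega^2L^2)}}{\frac1{1+\varrho}-(1-\lambda_{\max})^2},\qquad M=\frac{\varrho\,c(\rho)^2\,\tau}{\Omega(1+\varrho)(1+\eta)}.$$ Assumption A. (i) $F$ is continuous. (ii) There is a constant $0<L\le\frac1{2\omega}$ with $\|F_i'(u)\|\le L$ for all $u\in B_{\rho+c(\rho)}(u_0)$ and all $i$, and a constant $0<\eta<1$ with $\|F_i(\bar u)-F_i(u)-F_i'(u)(\bar u-u)\|\le\eta\|F_i(\bar u)-F_i(u)\|$ for all $u,\bar u\in B_{\rho+c(\rho)}(u_0)$ and all $i$. (iii) $F(u)=y^\dagger$ has a solution $\hat u\in B_\rho(u_0)$. *)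

theory Defs
  imports "HOL-Probability.Probability"
begin

text \<open>
  Conventions. A Hilbert space is a complete type of class \<^class>\<open>real_inner\<close>. The index set
  \<open>{0, \<dots>, P - 1}\<close> is a finite type \<open>'p\<close>, so \<open>P = CARD('p) \<ge> 1\<close>. As the spaces \<open>Y\<^sub>i\<close> may
  differ from each other, they are closed subspaces \<open>Y i\<close> of one Hilbert space \<open>'y\<close>; this is no
  restriction, since a finite family of Hilbert spaces embeds isometrically into its direct sum.
  The product \<open>Y\<^sub>0 \<times> \<dots> \<times> Y\<^sub>P\<^sub>-\<^sub>1\<close> sits inside \<open>'y ^ 'p\<close>, whose inner product is the sum of the
  inner products of the components.

  HOL functions are total: \<open>F i\<close> is only meaningful on its domain \<open>D i\<close>.
\<close>

definition joint_op :: "('p::finite \<Rightarrow> 'u \<Rightarrow> 'y) \<Rightarrow> 'u \<Rightarrow> 'y ^ 'p" where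
  "joint_op F u = (\<chi> i. F i u)"

text \<open>The set \<open>\<D>\<^sub>r(u)\<close> of solutions of \<open>F(v) = y\<close> in the closed ball of radius \<open>r\<close> around \<open>u\<close>.\<close>

definition solution_set ::
  "('p::finite \<Rightarrow> 'u::metric_space set) \<Rightarrow> ('p \<Rightarrow> 'u \<Rightarrow> 'y) \<Rightarrow> 'y ^ 'p \<Rightarrow> real \<Rightarrow> 'u \<Rightarrow> 'u set" where
  "solution_set D F y r u = {v \<in> cball u r. v \<in> (\<Inter>i. D i) \<and> joint_op F v = y}"

text \<open>
  The iteration along a fixed realization \<open>i 0, i 1, \<dots>\<close> of the indices. The constant
  \<^const>\<open>adjoint\<close> is defined by Hilbert choice; on Hilbert spaces the adjoint of a bounded operator
  exists and is unique. If the operator has values in \<open>Y i\<close>, the restriction of its adjoint to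
  \<open>Y i\<close> is the adjoint of the operator regarded as a map into \<open>Y i\<close>.
\<close>

primrec irsgd ::
  "('p \<Rightarrow> 'u \<Rightarrow> 'y::real_inner) \<Rightarrow> ('p \<Rightarrow> 'u \<Rightarrow> ('u \<Rightarrow>\<^sub>L 'y)) \<Rightarrow> 'y ^ 'p \<Rightarrow> (nat \<Rightarrow> real) \<Rightarrow> (nat \<Rightarrow> real) \<Rightarrow>
   'u::real_inner \<Rightarrow> (nat \<Rightarrow> 'p::finite) \<Rightarrow> nat \<Rightarrow> 'u" where
  "irsgd F F' y oms lams u0 i 0 = u0"
| "irsgd F F' y oms lams u0 i (Suc k) =
     (let u = irsgd F F' y oms lams u0 i k in
        u - oms k *\<^sub>R adjoint (blinfun_apply (F' (i k) u)) (F (i k) u - y $ i k)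
          - lams k *\<^sub>R (u - u0))"

text \<open>Below \<open>vrho\<close> is the small parameter written varrho (distinct from the radius \<open>\<rho>\<close>) and \<open>lmax\<close> the bound on the regularization parameters \<open>lams k\<close>.\<close>

definition c_const :: "real \<Rightarrow> real \<Rightarrow> real \<Rightarrow> real \<Rightarrow> real \<Rightarrow> real \<Rightarrow> real" where
  "c_const lmax vrho \<kappa> \<Omega> L \<rho> =
     \<rho> * lmax *
     ((1 - lmax) +
        sqrt ((1 - lmax)\<^sup>2 + (1 / (1 + vrho) - (1 - lmax)\<^sup>2) * (1 + \<Omega>\<^sup>2 * L\<^sup>2 / \<kappa>\<^sup>2))) /
     (1 / (1 + vrho) - (1 - lmax)\<^sup>2)"

definition M_const :: "real \<Rightarrow> real \<Rightarrow> real \<Rightarrow> real \<Rightarrow> real \<Rightarrow> real \<Rightarrow> real \<Rightarrow> real \<Rightarrow> real" where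
  "M_const lmax vrho \<kappa> \<Omega> L \<rho> \<tau> \<eta> =
     vrho * (c_const lmax vrho \<kappa> \<Omega> L \<rho>)\<^sup>2 * \<tau> / (\<Omega> * (1 + vrho) * (1 + \<eta>))"

end

theory Submission
  imports Defs
begin

text \<open>
  The argument is pathwise first. By the tangential cone condition, for every solution \<open>v\<close> in the
  ball around \<open>u\<^sub>0\<close> one step satisfies
  \<open>\<parallel>u\<^sub>k\<^sub>+\<^sub>1 - v\<parallel>\<^sup>2 + D\<^sub>2 \<parallel>r\<^sub>k\<parallel>\<^sup>2 \<le> \<parallel>u\<^sub>k - v\<parallel>\<^sup>2 + C \<lambda>\<^sub>k\<close>, where \<open>r\<^sub>k\<close> is the residual used in
  the step. The radius \<open>c(\<rho>)\<close> is the positive root of the quadratic that arises from the case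
  \<open>\<lambda>\<^sub>k = \<lambda>\<^sub>m\<^sub>a\<^sub>x\<close> of a sharper form of this estimate, and therefore no path leaves the ball of radius
  \<open>c(\<rho>)\<close> around the solution \<open>uhat\<close>. As \<open>i\<^sub>k\<close> is uniform and independent of \<open>u\<^sub>k\<close>, taking
  expectations makes \<open>E\<parallel>F(u\<^sub>k) - y\<parallel>\<^sup>2\<close> summable. Comparison with the iterate of smallest expected
  residual then shows that \<open>u\<^sub>k\<close> is a Cauchy sequence in mean square. So a subsequence converges
  almost surely, its limit is a solution, and the quasi-Fejer estimate for this limit yields the
  almost sure convergence of the whole sequence. Dominated convergence gives the mean square limit.
\<close>

section \<open>Adjoints on Hilbert spaces\<close>

text \<open>The representing vector is the minimizer of the quadratic functional \<open>J\<close>.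
  Minimizing sequences are Cauchy by the parallelogram identity, and at the minimum the first
  variation in every direction vanishes.\<close>

lemma riesz_representation:
  fixes f :: "'a::{real_inner, complete_space} \<Rightarrow> real"
  assumes "bounded_linear f"
  shows "\<exists>z. \<forall>x. f x = inner x z"
proof -
  interpret f: bounded_linear f by fact
  define J where "J x = (norm x)\<^sup>2 - 2 * f x" for x
  obtain K where K: "\<And>x. norm (f x) \<le> norm x * K"
    using f.bounded by blast
  have J_ge: "- K\<^sup>2 \<le> J x" for x
  proof -
    have "f x \<le> norm x * K" using K[of x] by simp
    then show ?thesis
      unfolding J_def using zero_le_power2[of "norm x - K"] by (simp add: power2_diff)
  qed
  define m where "m = Inf (range J)"
  have bdd: "bdd_below (range J)"
    using J_ge by (meson bdd_below.I2)
  have m_le: "m \<le> J x" for x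
    unfolding m_def using bdd by (simp add: cInf_lower)
  have "\<exists>x. J x < m + inverse (real (Suc n))" for n
    using cInf_lessD[of "range J" "m + inverse (real (Suc n))"] by (auto simp: m_def)
  then obtain x where x: "\<And>n. J (x n) < m + inverse (real (Suc n))"
    by metis
  \<comment> \<open>Parallelogram identity for \<open>J\<close>: the linear parts cancel against the
    value at the midpoint, which is at least the infimum \<open>m\<close>.\<close>
  have para: "(norm (a - b))\<^sup>2 \<le> 2 * (J a - m) + 2 * (J b - m)" for a b
  proof -
    have "(norm (a - b))\<^sup>2 = 2 * J a + 2 * J b - 4 * J ((1/2) *\<^sub>R (a + b))"
      unfolding J_def
      unfolding power2_norm_eq_inner f.scaleR f.add
      by (simp add: inner_simps inner_commute algebra_simps)
    then show ?thesis using m_le[of "(1/2) *\<^sub>R (a + b)"] by simp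
  qed
  have "Cauchy x"
  proof (rule CauchyI)
    fix e :: real assume "0 < e"
    then obtain N where N: "inverse (real (Suc N)) < e\<^sup>2 / 4"
      using reals_Archimedean[of "e\<^sup>2 / 4"] by auto
    have tail: "4 * (J (x n) - m) < e\<^sup>2" if "N \<le> n" for n
    proof -
      have "inverse (real (Suc n)) \<le> inverse (real (Suc N))"
        using that by (intro le_imp_inverse_le) auto
      then have "J (x n) - m < e\<^sup>2 / 4" using x[of n] N by linarith
      then show ?thesis by simp
    qed
    have "norm (x i - x j) < e" if "N \<le> i" "N \<le> j" for i j
    proof (rule power2_less_imp_less)
      show "(norm (x i - x j))\<^sup>2 < e\<^sup>2"
        using para[of "x i" "x j"] tail[OF that(1)] tail[OF that(2)] by linarith
    qed (use \<open>0 < e\<close> in simp)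
    then show "\<exists>M. \<forall>m\<ge>M. \<forall>n\<ge>M. norm (x m - x n) < e" by blast
  qed
  then obtain z where z: "x \<longlonglongrightarrow> z"
    using Cauchy_convergent_iff convergent_def by blast
  have "(\<lambda>n. J (x n)) \<longlonglongrightarrow> J z"
    unfolding J_def by (intro tendsto_intros z f.tendsto)
  moreover have "(\<lambda>n. m + inverse (real (Suc n))) \<longlonglongrightarrow> m + 0"
    by (intro tendsto_intros LIMSEQ_inverse_real_of_nat)
  ultimately have Jz: "J z \<le> m"
    using x by (intro LIMSEQ_le[of "\<lambda>n. J (x n)" "J z" _ m]) (auto intro: less_imp_le)
  have "f h = inner h z" for h
  proof (rule ccontr)
    assume ne: "f h \<noteq> inner h z"
    then have h: "h \<noteq> 0" using f.zero by auto
    define d where "d = inner h z - f h"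
    \<comment> \<open>This \<open>t\<close> minimizes the quadratic polynomial
      \<open>J (z + t *\<^sub>R h)\<close> in \<open>t\<close>; a nonzero \<open>d\<close> would
      push its value strictly below the infimum.\<close>
    define t where "t = - d / (norm h)\<^sup>2"
    have "J (z + t *\<^sub>R h) = J z + (t\<^sup>2 * (norm h)\<^sup>2 + 2 * t * d)"
      unfolding J_def d_def power2_norm_eq_inner
      by (simp add: f.add f.scaleR inner_simps inner_commute power2_eq_square algebra_simps)
    also have "t\<^sup>2 * (norm h)\<^sup>2 + 2 * t * d = - d\<^sup>2 / (norm h)\<^sup>2"
      using h by (simp add: t_def power2_eq_square field_simps)
    finally have "J (z + t *\<^sub>R h) < J z"
      using h ne by (simp add: d_def)
    then show False using m_le[of "z + t *\<^sub>R h"] Jz by linarith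
  qed
  then show ?thesis by blast
qed

text \<open>Since \<open>adjoint\<close> is a Hilbert choice, its defining property holds once some
  adjoint exists; Riesz representation of \<open>inner (f x) y\<close> for each \<open>y\<close>
  provides one.\<close>

lemma inner_adjoint:
  fixes f :: "'a::{real_inner, complete_space} \<Rightarrow> 'b::real_inner"
  assumes "bounded_linear f"
  shows "inner x (adjoint f y) = inner (f x) y"
proof -
  have "\<exists>z. \<forall>x. inner (f x) y = inner x z" for y
    using assms by (intro riesz_representation bounded_linear_compose[OF bounded_linear_inner_left])
  then have "\<exists>g. \<forall>x y. inner (f x) y = inner x (g y)"
    by metis
  then show ?thesis
    unfolding adjoint_def by (rule someI2_ex) simp
qed

text \<open>Testing the adjoint identity with the adjoint vector itself turns its squared norm into
  \<open>inner (A ?z) y\<close>.\<close>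

lemma norm_adjoint_blinfun_le:
  fixes A :: "'a::{real_inner, complete_space} \<Rightarrow>\<^sub>L 'b::real_inner"
  shows "norm (adjoint (blinfun_apply A) y) \<le> norm A * norm y"
proof -
  let ?z = "adjoint (blinfun_apply A) y"
  have "norm ?z * norm ?z = inner (A ?z) y"
    using inner_adjoint[OF blinfun.bounded_linear_right, of ?z A y]
    by (simp flip: power2_norm_eq_inner add: power2_eq_square)
  also have "\<dots> \<le> norm (A ?z) * norm y"
    by (rule norm_cauchy_schwarz)
  also have "\<dots> \<le> norm A * norm ?z * norm y"
    by (intro mult_right_mono norm_blinfun) simp
  finally have "norm ?z * norm ?z \<le> (norm A * norm y) * norm ?z"
    by (simp add: mult_ac)
  then show ?thesis
    by (cases "?z = 0") auto
qed

section \<open>Quasi-monotone sequences and the radius\<close>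

text \<open>Subtracting the partial sums of \<open>b\<close> leaves a decreasing sequence bounded
  below by \<open>- suminf b\<close>.\<close>

lemma convergent_quasi_decseq:
  fixes x b :: "nat \<Rightarrow> real"
  assumes "summable b" "\<And>n. x (Suc n) \<le> x n + b n" "\<And>n. 0 \<le> x n" "\<And>n. 0 \<le> b n"
  shows "convergent x"
proof -
  define y where "y n = x n - (\<Sum>j<n. b j)" for n
  have "decseq y"
    by (rule decseq_SucI) (use assms(2) in \<open>simp add: y_def algebra_simps\<close>)
  moreover have "- suminf b \<le> y n" for n
    using sum_le_suminf[of b "{..<n}"] assms(1) assms(3)[of n] assms(4) by (simp add: y_def)
  ultimately obtain l where "y \<longlonglongrightarrow> l"
    using decseq_convergent[of y "- suminf b"] by blast
  then have "(\<lambda>n. y n + (\<Sum>j<n. b j)) \<longlonglongrightarrow> l + suminf b"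
    using assms(1) by (intro tendsto_add summable_LIMSEQ)
  then show ?thesis
    by (auto simp: y_def convergent_def)
qed

lemma summable_quasi_decseq:
  fixes x b g :: "nat \<Rightarrow> real"
  assumes "summable b" "\<And>n. x (Suc n) + g n \<le> x n + b n" "\<And>n. 0 \<le> x n" "\<And>n. 0 \<le> b n"
    "\<And>n. 0 \<le> g n"
  shows "summable g"
proof (rule bounded_imp_summable)
  show "(\<Sum>j\<le>n. g j) \<le> x 0 + suminf b" for n
  proof -
    have "x (Suc n) + (\<Sum>j\<le>n. g j) \<le> x 0 + (\<Sum>j\<le>n. b j)"
    proof (induction n)
      case (Suc n)
      then show ?case using assms(2)[of "Suc n"] by simp
    qed (use assms(2)[of 0] in simp)
    moreover have "(\<Sum>j\<le>n. b j) \<le> suminf b"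
      using assms by (intro sum_le_suminf) auto
    ultimately show ?thesis using assms(3)[of "Suc n"] by linarith
  qed
qed (fact assms(5))

text \<open>By its closed formula, \<open>c\<close> is the nonnegative root of the quadratic
  equation \<open>root\<close>. Its leading coefficient \<open>d\<close> is at most
  \<open>1 - a\<^sup>2\<close>, because \<open>1 / (1 + vrho)\<close> is at most 1, and this slack
  gives the second claim. These are the two facts that keep the iterates in a ball of radius
  \<open>c\<close>.\<close>

lemma c_const_properties:
  fixes lmax vrho \<kappa> \<Omega> L \<rho> :: real
  defines "c \<equiv> c_const lmax vrho \<kappa> \<Omega> L \<rho>"
  assumes "0 \<le> lmax" "lmax < 1 / 2" "0 < \<rho>" "0 < \<kappa>" "0 < vrho" "(1 - lmax)\<^sup>2 < 1 / (1 + vrho)"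
  shows "\<rho> \<le> c"
    and "((1 - lmax) * c + lmax * \<rho>)\<^sup>2 + lmax\<^sup>2 * \<rho>\<^sup>2 * (\<Omega>\<^sup>2 * L\<^sup>2 / \<kappa>\<^sup>2) \<le> c\<^sup>2"
proof -
  define a d q S where "a = 1 - lmax" and "d = 1 / (1 + vrho) - a\<^sup>2"
    and "q = \<Omega>\<^sup>2 * L\<^sup>2 / \<kappa>\<^sup>2" and "S = sqrt (a\<^sup>2 + d * (1 + q))"
  have d: "0 < d" and q: "0 \<le> q" and a: "0 < a" "a \<le> 1"
    using assms by (auto simp: d_def q_def a_def)
  have c: "c = \<rho> * lmax * (a + S) / d"
    by (simp add: c_def c_const_def a_def d_def q_def S_def)
  have S2: "S\<^sup>2 = a\<^sup>2 + d * (1 + q)"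
    using d q by (simp add: S_def)
  have "a < S"
    using d q a unfolding S_def by (intro real_less_rsqrt) (simp add: add_pos_nonneg)
  have d_le: "d \<le> 1 - a\<^sup>2"
    using assms by (simp add: d_def field_simps)
  also have "1 - a\<^sup>2 = lmax * (1 + a)"
    by (simp add: a_def power2_eq_square algebra_simps)
  finally have d_le': "d \<le> lmax * (1 + a)" .
  have "0 \<le> c"
    unfolding c using assms d a \<open>a < S\<close> by (intro divide_nonneg_pos mult_nonneg_nonneg) auto
  \<comment> \<open>The equation is checked after multiplication by \<open>d\<close>: then only
    \<open>d * c\<close> and the square of the root \<open>S\<close> occur, and both are known
    explicitly.\<close>
  have root: "d * c\<^sup>2 = 2 * lmax * a * \<rho> * c + lmax\<^sup>2 * \<rho>\<^sup>2 * (1 + q)"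
  proof -
    have dc: "d * c = \<rho> * lmax * (a + S)" using d by (simp add: c)
    have "d * (d * c\<^sup>2) = (d * c)\<^sup>2" by (simp add: power2_eq_square)
    also have "\<dots> = \<rho>\<^sup>2 * lmax\<^sup>2 * (a\<^sup>2 + 2 * a * S + S\<^sup>2)"
      unfolding dc by (simp add: power2_eq_square algebra_simps)
    also have "\<dots> = 2 * lmax * a * \<rho> * (d * c) + d * (lmax\<^sup>2 * \<rho>\<^sup>2 * (1 + q))"
      unfolding dc S2 by (simp add: power2_eq_square algebra_simps)
    finally have "d * (d * c\<^sup>2) = d * (2 * lmax * a * \<rho> * c + lmax\<^sup>2 * \<rho>\<^sup>2 * (1 + q))"
      by (simp add: algebra_simps)
    then show ?thesis using d by simp
  qed
  have "d * c\<^sup>2 \<le> (1 - a\<^sup>2) * c\<^sup>2"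
    using d_le by (intro mult_right_mono) auto
  then show "((1 - lmax) * c + lmax * \<rho>)\<^sup>2 + lmax\<^sup>2 * \<rho>\<^sup>2 * (\<Omega>\<^sup>2 * L\<^sup>2 / \<kappa>\<^sup>2) \<le> c\<^sup>2"
    unfolding q_def[symmetric] a_def[symmetric] using root
    by (simp add: power2_eq_square algebra_simps)
  show "\<rho> \<le> c"
  proof (rule ccontr)
    assume "\<not> \<rho> \<le> c"
    then have "c < \<rho>" by simp
    \<comment> \<open>For \<open>lmax = 0\<close> the bound on \<open>d\<close> would contradict its
      positivity. So \<open>lmax\<close> can be cancelled from \<open>root\<close>, and as
      \<open>1 + a = 2 * a + lmax\<close>, comparing the two sides term by term contradicts
      \<open>c < \<rho>\<close>.\<close>
    have "0 < lmax" using d d_le' a assms(2) by (cases "lmax = 0") auto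
    have "(1 - a\<^sup>2) * c\<^sup>2 = lmax * ((1 + a) * c\<^sup>2)"
      by (simp add: a_def power2_eq_square algebra_simps)
    moreover have "2 * lmax * a * \<rho> * c + lmax\<^sup>2 * \<rho>\<^sup>2 * (1 + q)
        = lmax * (2 * a * \<rho> * c + lmax * \<rho>\<^sup>2 * (1 + q))"
      by (simp add: power2_eq_square algebra_simps)
    ultimately have "2 * a * \<rho> * c + lmax * \<rho>\<^sup>2 * (1 + q) \<le> (1 + a) * c\<^sup>2"
      using \<open>d * c\<^sup>2 \<le> _\<close> root mult_le_cancel_left_pos[OF \<open>0 < lmax\<close>] by metis
    moreover have "c\<^sup>2 \<le> \<rho> * c"
      using \<open>0 \<le> c\<close> \<open>c < \<rho>\<close> by (simp add: power2_eq_square mult_right_mono)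
    then have "2 * a * c\<^sup>2 \<le> 2 * a * (\<rho> * c)"
      using a by simp
    moreover have "c\<^sup>2 < \<rho>\<^sup>2"
      using \<open>0 \<le> c\<close> \<open>c < \<rho>\<close> by (intro power_strict_mono) auto
    then have "lmax * c\<^sup>2 < lmax * \<rho>\<^sup>2"
      using \<open>0 < lmax\<close> by simp
    moreover have "0 \<le> lmax * \<rho>\<^sup>2 * q"
      using \<open>0 < lmax\<close> q by simp
    moreover have "(1 + a) * c\<^sup>2 = 2 * a * c\<^sup>2 + lmax * c\<^sup>2"
      by (simp add: a_def algebra_simps)
    ultimately show False
      by (simp add: algebra_simps)
  qed
qed

section \<open>The iteration along a fixed index sequence\<close>

text \<open>The radius \<open>c\<close> enters only through the two inequalities that
  \<open>c_const_properties\<close> proves for \<open>c_const\<close>. The estimates on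
  \<open>F\<close> and \<open>F'\<close> are confined to the ball around \<open>u0\<close>, so every
  later use must first place its points there.\<close>

locale irsgd_ball =
  fixes F :: "'p::finite \<Rightarrow> 'u::{real_inner, complete_space} \<Rightarrow> 'y::real_inner"
    and F' :: "'p \<Rightarrow> 'u \<Rightarrow> ('u \<Rightarrow>\<^sub>L 'y)"
    and yd :: "'y ^ 'p"
    and u0 uhat :: 'u
    and oms lams :: "nat \<Rightarrow> real"
    and \<omega> \<Omega> lmax \<rho> \<kappa> L \<eta> c :: real
  assumes steps: "0 < \<omega>" "\<And>k. \<omega> \<le> oms k" "\<And>k. oms k \<le> \<Omega>"
    and regs: "\<And>k. 0 \<le> lams k" "\<And>k. lams k \<le> lmax" "lmax < 1"
    and constants: "0 < \<kappa>" "0 \<le> L" "0 \<le> \<eta>" "\<eta> < 1" "0 \<le> \<rho>" "\<rho> \<le> c"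
    and radius: "((1 - lmax) * c + lmax * \<rho>)\<^sup>2 + lmax\<^sup>2 * \<rho>\<^sup>2 * (\<Omega>\<^sup>2 * L\<^sup>2 / \<kappa>\<^sup>2) \<le> c\<^sup>2"
    and descent: "0 < 2 * \<omega> * (1 - lmax) * (1 - \<eta>) - \<Omega>\<^sup>2 * L\<^sup>2 - \<kappa>\<^sup>2"
    and deriv_bound: "\<And>i v. v \<in> cball u0 (\<rho> + c) \<Longrightarrow> norm (F' i v) \<le> L"
    and tangential_cone: "\<And>i v v'. v \<in> cball u0 (\<rho> + c) \<Longrightarrow> v' \<in> cball u0 (\<rho> + c) \<Longrightarrow>
           norm (F i v' - F i v - blinfun_apply (F' i v) (v' - v)) \<le> \<eta> * norm (F i v' - F i v)"
    and uhat: "norm (u0 - uhat) \<le> \<rho>" "\<And>i. F i uhat = yd $ i"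
begin

definition D2 :: real where "D2 = 2 * \<omega> * (1 - lmax) * (1 - \<eta>) - \<Omega>\<^sup>2 * L\<^sup>2 - \<kappa>\<^sup>2"

definition iter :: "(nat \<Rightarrow> 'p) \<Rightarrow> nat \<Rightarrow> 'u" where
  "iter i k = irsgd F F' yd oms lams u0 i k"

definition residual :: "'u \<Rightarrow> real" where
  "residual x = (\<Sum>i\<in>UNIV. (norm (F i x - yd $ i))\<^sup>2)"

lemma iter_0: "iter i 0 = u0"
  by (simp add: iter_def)

lemma iter_Suc:
  "iter i (Suc k) = iter i k
     - oms k *\<^sub>R adjoint (blinfun_apply (F' (i k) (iter i k))) (F (i k) (iter i k) - yd $ i k)
     - lams k *\<^sub>R (iter i k - u0)"
  by (simp add: iter_def Let_def)

text \<open>Iterate \<open>k\<close> is determined by the indices strictly before \<open>k\<close>.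
  This is the source of the independence of the index drawn at step \<open>k\<close> from the
  current iterate.\<close>

lemma iter_cong: "(\<And>j. j < k \<Longrightarrow> a j = b j) \<Longrightarrow> iter a k = iter b k"
  by (induction k) (simp_all add: iter_0 iter_Suc)

lemma residual_nonneg: "0 \<le> residual x"
  by (simp add: residual_def sum_nonneg)

lemma component_le_residual: "(norm (F i x - yd $ i))\<^sup>2 \<le> residual x"
  unfolding residual_def by (intro member_le_sum) auto

lemma \<Omega>_pos: "0 < \<Omega>"
  using steps(1) steps(2)[of 0] steps(3)[of 0] by linarith

lemma oms_pos: "0 < oms k"
  using steps(1) steps(2)[of k] by linarith

lemma cball_uhat_subset: "cball uhat c \<subseteq> cball u0 (\<rho> + c)"
proof
  fix x assume "x \<in> cball uhat c"
  then show "x \<in> cball u0 (\<rho> + c)"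
    using uhat(1) norm_diff_triangle_le[of u0 uhat \<rho> x c] by (simp add: dist_norm)
qed

text \<open>The new error is \<open>b - w *\<^sub>R g\<close>, where \<open>b\<close> is a convex
  combination of the old error \<open>e\<close> and the initial error \<open>h\<close>. In the
  expanded square, the cone condition bounds the term with \<open>e\<close> and Young's inequality
  the term with \<open>h\<close>; what is left of the squared residual has the coefficient
  \<open>D2\<close>.\<close>

lemma step_le:
  fixes i x v k
  defines "r \<equiv> F i x - yd $ i"
  assumes x: "x \<in> cball u0 (\<rho> + c)" and v: "v \<in> cball u0 (\<rho> + c)" "F i v = yd $ i"
  shows "(norm (x - oms k *\<^sub>R adjoint (blinfun_apply (F' i x)) r - lams k *\<^sub>R (x - u0) - v))\<^sup>2
           + D2 * (norm r)\<^sup>2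
         \<le> ((1 - lams k) * norm (x - v) + lams k * norm (u0 - v))\<^sup>2
           + (lams k)\<^sup>2 * (norm (u0 - v))\<^sup>2 * (\<Omega>\<^sup>2 * L\<^sup>2 / \<kappa>\<^sup>2)"
proof -
  define l w A where "l = lams k" and "w = oms k" and "A = F' i x"
  define g e h where "g = adjoint (blinfun_apply A) r" and "e = x - v" and "h = u0 - v"
  define b where "b = (1 - l) *\<^sub>R e + l *\<^sub>R h"
  have l: "0 \<le> l" "l \<le> lmax" "l < 1" and w: "0 < w" "\<omega> \<le> w" "w \<le> \<Omega>"
    using regs(1,2)[of k] regs(3) steps(2,3)[of k] oms_pos[of k] by (auto simp: l_def w_def)
  have A: "norm A \<le> L" using deriv_bound x by (simp add: A_def)
  have "x - w *\<^sub>R g - l *\<^sub>R (x - u0) - v = b - w *\<^sub>R g"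
    by (simp add: b_def e_def h_def algebra_simps)
  then have "(norm (x - w *\<^sub>R g - l *\<^sub>R (x - u0) - v))\<^sup>2
      = (norm b)\<^sup>2 - 2 * w * inner b g + w\<^sup>2 * (norm g)\<^sup>2"
    unfolding power2_norm_eq_inner
    by (simp add: inner_simps inner_commute power2_eq_square algebra_simps)
  moreover have "inner b g = (1 - l) * inner (A e) r + l * inner (A h) r"
    unfolding g_def inner_adjoint[OF blinfun.bounded_linear_right]
    by (simp add: b_def blinfun.add_right blinfun.scaleR_right inner_simps)
  then have "2 * w * inner b g = 2 * (w * (1 - l) * inner (A e) r) + 2 * w * l * inner (A h) r"
    by (simp only: distrib_left mult.assoc mult.left_commute)
  \<comment> \<open>As \<open>v\<close> solves the equation, \<open>A e - r\<close> is the
    linearization error between the current point and \<open>v\<close>. Hence \<open>A e\<close>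
    deviates from \<open>r\<close> by at most the fraction \<eta> of its norm.\<close>
  moreover have "\<omega> * (1 - lmax) * ((1 - \<eta>) * (norm r)\<^sup>2) \<le> w * (1 - l) * inner (A e) r"
  proof -
    have "norm (F i v - F i x - A (v - x)) \<le> \<eta> * norm (F i v - F i x)"
      unfolding A_def using tangential_cone x v by blast
    moreover have "F i v - F i x - A (v - x) = A e - r"
      by (simp add: r_def v e_def blinfun.diff_right)
    moreover have "norm (F i v - F i x) = norm r"
      by (simp add: r_def v norm_minus_commute)
    ultimately have "norm (A e - r) * norm r \<le> (\<eta> * norm r) * norm r"
      by (intro mult_right_mono) auto
    also have "\<dots> = \<eta> * (norm r)\<^sup>2"
      by (simp add: power2_eq_square)
    finally have "norm (A e - r) * norm r \<le> \<eta> * (norm r)\<^sup>2" .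
    moreover have "- (norm (A e - r) * norm r) \<le> inner (A e - r) r"
      using Cauchy_Schwarz_ineq2[of "A e - r" r] by linarith
    moreover have "inner (A e - r) r = inner (A e) r - (norm r)\<^sup>2"
      by (simp add: inner_diff_left power2_norm_eq_inner)
    ultimately have 1: "(1 - \<eta>) * (norm r)\<^sup>2 \<le> inner (A e) r"
      unfolding left_diff_distrib by linarith
    have 2: "\<omega> * (1 - lmax) \<le> w * (1 - l)"
      using l w regs(3) steps(1) by (intro mult_mono) auto
    show ?thesis
      using 2 1 l w constants regs(3) by (intro mult_mono) auto
  qed
  \<comment> \<open>Young's inequality with weight \<kappa>: one part is absorbed by the descent in
    the residual, the other is of second order in \<open>l\<close>.\<close>
  moreover have "- (2 * w * l * inner (A h) r)
      \<le> \<kappa>\<^sup>2 * (norm r)\<^sup>2 + l\<^sup>2 * (norm h)\<^sup>2 * (\<Omega>\<^sup>2 * L\<^sup>2 / \<kappa>\<^sup>2)"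
  proof -
    have "norm (A h) \<le> L * norm h"
      using norm_blinfun[of A h] mult_right_mono[OF A, of "norm h"] by simp
    then have "- inner (A h) r \<le> L * norm h * norm r"
      using Cauchy_Schwarz_ineq2[of "A h" r] mult_right_mono[of "norm (A h)" "L * norm h" "norm r"]
      by simp
    then have "(2 * w * l) * (- inner (A h) r) \<le> (2 * w * l) * (L * norm h * norm r)"
      using l w by (intro mult_left_mono) auto
    also have "\<dots> \<le> (2 * \<Omega> * l) * (L * norm h * norm r)"
      using l w constants by (intro mult_right_mono) auto
    also have "\<dots> = 2 * (\<kappa> * norm r) * (l * norm h * \<Omega> * L / \<kappa>)"
      using constants(1) by simp
    also have "\<dots> \<le> (\<kappa> * norm r)\<^sup>2 + (l * norm h * \<Omega> * L / \<kappa>)\<^sup>2"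
      by (rule sum_squares_bound)
    finally show ?thesis
      by (simp add: power_mult_distrib power_divide mult_ac)
  qed
  moreover have "w\<^sup>2 * (norm g)\<^sup>2 \<le> \<Omega>\<^sup>2 * (L\<^sup>2 * (norm r)\<^sup>2)"
  proof -
    have "norm g \<le> L * norm r"
      unfolding g_def
      using norm_adjoint_blinfun_le[of A r] mult_right_mono[OF A, of "norm r"] by simp
    then have "(norm g)\<^sup>2 \<le> L\<^sup>2 * (norm r)\<^sup>2"
      unfolding power_mult_distrib[symmetric] by (intro power_mono) auto
    then show ?thesis
      using w by (intro mult_mono power_mono) auto
  qed
  moreover have "(norm b)\<^sup>2 \<le> ((1 - l) * norm e + l * norm h)\<^sup>2"
    using norm_triangle_ineq[of "(1 - l) *\<^sub>R e" "l *\<^sub>R h"] l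
    by (intro power_mono) (auto simp: b_def)
  moreover have "D2 * (norm r)\<^sup>2 = 2 * (\<omega> * (1 - lmax) * ((1 - \<eta>) * (norm r)\<^sup>2))
      - \<Omega>\<^sup>2 * (L\<^sup>2 * (norm r)\<^sup>2) - \<kappa>\<^sup>2 * (norm r)\<^sup>2"
    by (simp add: D2_def algebra_simps)
  ultimately have "(norm (x - w *\<^sub>R g - l *\<^sub>R (x - u0) - v))\<^sup>2 + D2 * (norm r)\<^sup>2
      \<le> ((1 - l) * norm e + l * norm h)\<^sup>2 + l\<^sup>2 * (norm h)\<^sup>2 * (\<Omega>\<^sup>2 * L\<^sup>2 / \<kappa>\<^sup>2)"
    by linarith
  then show ?thesis
    by (simp add: l_def w_def A_def g_def e_def h_def)
qed

text \<open>As a function of \<open>l\<close> the left-hand side is convex, with value \<open>c\<^sup>2\<close> at \<open>0\<close>.\<close>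

lemma radius_le:
  assumes "0 \<le> l" "l \<le> lmax"
  shows "((1 - l) * c + l * \<rho>)\<^sup>2 + l\<^sup>2 * \<rho>\<^sup>2 * (\<Omega>\<^sup>2 * L\<^sup>2 / \<kappa>\<^sup>2) \<le> c\<^sup>2"
proof (cases "l = 0")
  case False
  then have "0 < l" "0 < lmax" using assms by auto
  define \<beta> where "\<beta> = - 2 * c * (c - \<rho>)"
  define \<gamma> where "\<gamma> = (c - \<rho>)\<^sup>2 + \<rho>\<^sup>2 * (\<Omega>\<^sup>2 * L\<^sup>2 / \<kappa>\<^sup>2)"
  have eq: "((1 - l) * c + l * \<rho>)\<^sup>2 + l\<^sup>2 * \<rho>\<^sup>2 * (\<Omega>\<^sup>2 * L\<^sup>2 / \<kappa>\<^sup>2) = c\<^sup>2 + l * (\<beta> + l * \<gamma>)" for l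
    by (simp add: \<beta>_def \<gamma>_def power2_eq_square algebra_simps)
  have "lmax * (\<beta> + lmax * \<gamma>) \<le> 0"
    using radius unfolding eq by simp
  then have "\<beta> + lmax * \<gamma> \<le> 0"
    using \<open>0 < lmax\<close> by (simp add: mult_le_0_iff)
  moreover have "l * \<gamma> \<le> lmax * \<gamma>"
    using assms by (intro mult_right_mono) (auto simp: \<gamma>_def)
  ultimately have "l * (\<beta> + l * \<gamma>) \<le> 0"
    using assms(1) by (intro mult_nonneg_nonpos) auto
  then show ?thesis unfolding eq by simp
qed simp

text \<open>Induction with \<open>step_le\<close> at \<open>uhat\<close>: the distances of iterate
  and initial guess to \<open>uhat\<close> are at most \<open>c\<close> and \<rho>, and
  \<open>radius_le\<close> bounds the resulting expression. The induction hypothesis also puts the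
  iterate where the cone condition holds.\<close>

lemma iter_in_cball: "norm (iter i k - uhat) \<le> c"
proof (induction k)
  case 0
  then show ?case using uhat(1) constants(6) by (simp add: iter_0)
next
  case (Suc k)
  let ?x = "iter i k" and ?r = "F (i k) (iter i k) - yd $ i k"
  have x: "?x \<in> cball u0 (\<rho> + c)"
    using Suc cball_uhat_subset by (auto simp: dist_norm norm_minus_commute)
  have v: "uhat \<in> cball u0 (\<rho> + c)"
    using uhat(1) constants by (simp add: dist_norm)
  have "0 \<le> D2 * (norm ?r)\<^sup>2" using descent by (simp add: D2_def)
  then have "(norm (iter i (Suc k) - uhat))\<^sup>2
     \<le> ((1 - lams k) * norm (?x - uhat) + lams k * norm (u0 - uhat))\<^sup>2
           + (lams k)\<^sup>2 * (norm (u0 - uhat))\<^sup>2 * (\<Omega>\<^sup>2 * L\<^sup>2 / \<kappa>\<^sup>2)"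
    using step_le[OF x v uhat(2)[of "i k"], of k] unfolding iter_Suc by linarith
  also have "\<dots> \<le> ((1 - lams k) * c + lams k * \<rho>)\<^sup>2 + (lams k)\<^sup>2 * \<rho>\<^sup>2 * (\<Omega>\<^sup>2 * L\<^sup>2 / \<kappa>\<^sup>2)"
  proof (intro add_mono power_mono)
    have l: "0 \<le> lams k" "lams k \<le> 1" using regs(1,2)[of k] regs(3) by auto
    show "(1 - lams k) * norm (?x - uhat) \<le> (1 - lams k) * c"
      using Suc l by (intro mult_left_mono) auto
    show "lams k * norm (u0 - uhat) \<le> lams k * \<rho>"
      using uhat(1) l by (intro mult_left_mono) auto
    have "(norm (u0 - uhat))\<^sup>2 \<le> \<rho>\<^sup>2"
      using uhat(1) by (rule power_mono) simp
    then show "(lams k)\<^sup>2 * (norm (u0 - uhat))\<^sup>2 * (\<Omega>\<^sup>2 * L\<^sup>2 / \<kappa>\<^sup>2)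
        \<le> (lams k)\<^sup>2 * \<rho>\<^sup>2 * (\<Omega>\<^sup>2 * L\<^sup>2 / \<kappa>\<^sup>2)"
      by (intro mult_right_mono mult_left_mono) auto
    show "0 \<le> (1 - lams k) * norm (?x - uhat) + lams k * norm (u0 - uhat)"
      using l by simp
  qed
  also have "\<dots> \<le> c\<^sup>2"
    using regs(1,2)[of k] by (rule radius_le)
  finally show ?case
    by (rule power2_le_imp_le) (use constants in simp)
qed

lemma iter_in_domain: "iter i k \<in> cball u0 (\<rho> + c)"
  using iter_in_cball[of i k] cball_uhat_subset by (auto simp: dist_norm norm_minus_commute)

text \<open>With \<open>B = \<rho> + c\<close>, the error is at most \<open>2 * B\<close> and the
  initial error at most \<open>B\<close>. The mixed term of the square contributes 4, the term
  quadratic in \<open>l\<close> contributes 1, and the rest comes from Young's inequality.\<close>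

definition C where "C = (\<rho> + c)\<^sup>2 * (5 + \<Omega>\<^sup>2 * L\<^sup>2 / \<kappa>\<^sup>2)"

lemma C_nonneg: "0 \<le> C"
  by (simp add: C_def)

text \<open>A coarse form of \<open>step_le\<close>, linear in the regularization parameter because
  its square is at most itself. It is stated for all solutions in the ball, so that it also applies
  to a limit that depends on the path.\<close>

lemma quasi_fejer:
  assumes v: "v \<in> cball u0 (\<rho> + c)" "\<And>i. F i v = yd $ i"
  shows "(norm (iter i (Suc k) - v))\<^sup>2 + D2 * (norm (F (i k) (iter i k) - yd $ i k))\<^sup>2
         \<le> (norm (iter i k - v))\<^sup>2 + C * lams k"
proof -
  define l B e h q where "l = lams k" and "B = \<rho> + c" and "e = norm (iter i k - v)"
    and "h = norm (u0 - v)" and "q = \<Omega>\<^sup>2 * L\<^sup>2 / \<kappa>\<^sup>2"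
  have l: "0 \<le> l" "l \<le> 1" using regs(1,2)[of k] regs(3) by (auto simp: l_def)
  have h: "0 \<le> h" "h \<le> B" using v(1) by (auto simp: h_def B_def dist_norm)
  have e: "0 \<le> e" "e \<le> 2 * B"
    using iter_in_domain[of i k] v(1) norm_diff_triangle_ineq[of "iter i k" u0 u0 v]
    by (auto simp: e_def B_def dist_norm norm_minus_commute)
  have l2: "l\<^sup>2 \<le> l" using l by (simp add: power2_eq_square mult_left_le)
  have "((1 - l) * e + l * h)\<^sup>2 \<le> (e + l * B)\<^sup>2"
    using l h e by (intro power_mono add_mono mult_left_mono add_nonneg_nonneg)
      (auto simp: mult_left_le_one_le)
  also have "\<dots> = e\<^sup>2 + 2 * e * (l * B) + l\<^sup>2 * B\<^sup>2"
    by (simp add: power2_eq_square algebra_simps)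
  also have "\<dots> \<le> e\<^sup>2 + 2 * (2 * B) * (l * B) + l * B\<^sup>2"
    using l2 l h e by (intro add_mono mult_right_mono mult_left_mono) auto
  finally have "((1 - l) * e + l * h)\<^sup>2 \<le> e\<^sup>2 + 5 * (l * B\<^sup>2)"
    by (simp add: power2_eq_square algebra_simps)
  moreover have "l\<^sup>2 * h\<^sup>2 * q \<le> l * B\<^sup>2 * q"
    using l2 l h by (intro mult_right_mono mult_mono power_mono) (auto simp: q_def)
  ultimately show ?thesis
    using step_le[OF iter_in_domain[of i k] v(1) v(2)[of "i k"], of k]
    unfolding iter_Suc C_def l_def[symmetric] e_def[symmetric] h_def[symmetric] q_def[symmetric]
      B_def[symmetric] distrib_left distrib_right mult.assoc mult.commute[of "B\<^sup>2"]
    by (simp add: mult_ac)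
qed

text \<open>The adjoint moves the derivative onto \<open>x - uhat\<close>, which is split at the
  current iterate \<open>z\<close> into \<open>x - z\<close> and \<open>uhat - z\<close>. The cone
  condition bounds both images by residuals, so the bound is quadratic in residuals and becomes
  summable in expectation.\<close>

lemma increment_inner_le:
  assumes x: "norm (x - uhat) \<le> c"
  shows "\<bar>inner (iter i (Suc k) - iter i k) (x - uhat)\<bar>
    \<le> \<Omega> * (1 + \<eta>) * (5 / 2 * residual (iter i k) + 1 / 2 * residual x) + lams k * ((\<rho> + c) * c)"
proof -
  define z A p where "z = iter i k" and "A = F' (i k) z" and "p = i k"
  define r s where "r = F p z - yd $ p" and "s = F p x - yd $ p"
  have z: "z \<in> cball u0 (\<rho> + c)" and x': "x \<in> cball u0 (\<rho> + c)" and u: "uhat \<in> cball u0 (\<rho> + c)"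
    using iter_in_domain x cball_uhat_subset uhat(1) constants
    by (auto simp: z_def dist_norm norm_minus_commute)
  \<comment> \<open>The reverse use of the cone condition: the linearized difference is controlled
    by the nonlinear one.\<close>
  have lip: "norm (A (v - z)) \<le> (1 + \<eta>) * norm (F p v - F p z)" if "v \<in> cball u0 (\<rho> + c)" for v
    using tangential_cone[OF z that, of p]
      norm_triangle_sub[of "A (v - z)" "F p v - F p z"]
    by (simp add: A_def p_def norm_minus_commute algebra_simps)
  have "norm (A (x - uhat)) \<le> norm (A (x - z)) + norm (A (uhat - z))"
    using norm_triangle_ineq4[of "A (x - z)" "A (uhat - z)"]
    by (simp add: blinfun.diff_right)
  also have "\<dots> \<le> (1 + \<eta>) * (norm (F p x - F p z) + norm (F p uhat - F p z))"
    using lip[OF x'] lip[OF u] by (simp add: algebra_simps)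
  also have "\<dots> \<le> (1 + \<eta>) * (norm s + 2 * norm r)"
    using norm_triangle_ineq4[of s r] constants
    by (intro mult_left_mono) (auto simp: s_def r_def uhat norm_minus_commute)
  finally have A: "norm (A (x - uhat)) \<le> (1 + \<eta>) * (norm s + 2 * norm r)" .
  \<comment> \<open>Half of each square bounds the mixed product, which gives
    \<open>2 + 1 / 2 = 5 / 2\<close> for the current iterate.\<close>
  have rs: "norm r * (norm s + 2 * norm r) \<le> 5 / 2 * residual z + 1 / 2 * residual x"
    using sum_squares_bound[of "norm r" "norm s"] component_le_residual[of p z]
      component_le_residual[of p x]
    by (simp add: r_def s_def power2_eq_square algebra_simps)
  have "\<bar>inner (x - uhat) (adjoint (blinfun_apply A) r)\<bar> \<le> norm (A (x - uhat)) * norm r"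
    unfolding inner_adjoint[OF blinfun.bounded_linear_right] by (rule Cauchy_Schwarz_ineq2)
  also have "\<dots> \<le> (1 + \<eta>) * (norm s + 2 * norm r) * norm r"
    using A by (intro mult_right_mono) auto
  also have "\<dots> \<le> (1 + \<eta>) * (5 / 2 * residual z + 1 / 2 * residual x)"
    using rs constants by (simp add: mult_ac)
  finally have 1: "oms k * \<bar>inner (x - uhat) (adjoint (blinfun_apply A) r)\<bar>
      \<le> \<Omega> * ((1 + \<eta>) * (5 / 2 * residual z + 1 / 2 * residual x))"
    using steps(3)[of k] oms_pos[of k] by (intro mult_mono) auto
  have "\<bar>inner (x - uhat) (z - u0)\<bar> \<le> norm (x - uhat) * norm (z - u0)"
    by (rule Cauchy_Schwarz_ineq2)
  also have "\<dots> \<le> c * (\<rho> + c)"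
    using x z constants by (intro mult_mono) (auto simp: dist_norm norm_minus_commute)
  finally have 2: "lams k * \<bar>inner (x - uhat) (z - u0)\<bar> \<le> lams k * (c * (\<rho> + c))"
    using regs(1) by (intro mult_left_mono)
  have "inner (iter i (Suc k) - iter i k) (x - uhat)
     = - (oms k * inner (x - uhat) (adjoint (blinfun_apply A) r)) - lams k * inner (x - uhat) (z - u0)"
    unfolding iter_Suc by (simp add: z_def A_def r_def p_def inner_simps inner_commute)
  also have "\<bar>\<dots>\<bar> \<le> oms k * \<bar>inner (x - uhat) (adjoint (blinfun_apply A) r)\<bar>
      + lams k * \<bar>inner (x - uhat) (z - u0)\<bar>"
    using oms_pos[of k] regs(1)[of k]
      abs_triangle_ineq4[of "- (oms k * inner (x - uhat) (adjoint (blinfun_apply A) r))"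
        "lams k * inner (x - uhat) (z - u0)"]
    by (simp add: abs_mult)
  finally show ?thesis using 1 2 by (simp add: z_def mult_ac)
qed

end

section \<open>Random indices\<close>

text \<open>Sum and integral may be exchanged for nonnegative functions, and a function with finite
  integral is finite almost everywhere.\<close>

lemma AE_summable_of_summable_integral:
  fixes f :: "nat \<Rightarrow> 'a \<Rightarrow> real"
  assumes int: "\<And>n. integrable M (f n)" and nn: "\<And>n x. 0 \<le> f n x"
    and sum: "summable (\<lambda>n. integral\<^sup>L M (f n))"
  shows "AE x in M. summable (\<lambda>n. f n x)"
proof -
  have [measurable]: "f n \<in> borel_measurable M" for n
    using int by (rule borel_measurable_integrable)
  have "(\<integral>\<^sup>+x. (\<Sum>n. ennreal (f n x)) \<partial>M) = (\<Sum>n. \<integral>\<^sup>+x. ennreal (f n x) \<partial>M)"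
    by (intro nn_integral_suminf) measurable
  also have "\<dots> = (\<Sum>n. ennreal (integral\<^sup>L M (f n)))"
    using int nn by (intro suminf_cong nn_integral_eq_integral) auto
  also have "\<dots> = ennreal (\<Sum>n. integral\<^sup>L M (f n))"
    using sum nn by (intro suminf_ennreal2) auto
  finally have "(\<integral>\<^sup>+x. (\<Sum>n. ennreal (f n x)) \<partial>M) \<noteq> \<infinity>"
    by simp
  then have "AE x in M. (\<Sum>n. ennreal (f n x)) \<noteq> \<infinity>"
    by (intro nn_integral_PInf_AE) measurable
  then show ?thesis
    by eventually_elim (use nn in \<open>auto intro: summable_suminf_not_top\<close>)
qed

lemma convergent_of_summable_increments:
  fixes x :: "nat \<Rightarrow> 'a::{real_normed_vector, complete_space}"
  assumes "summable (\<lambda>j. norm (x (Suc j) - x j))"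
  shows "convergent x"
proof -
  let ?d = "\<lambda>j. norm (x (Suc j) - x j)"
  have le: "norm (x n - x m) \<le> sum ?d {m..<n}" if "m \<le> n" for m n
    using norm_sum[of "\<lambda>j. x (Suc j) - x j" "{m..<n}"] sum_Suc_diff'[OF that, of x] by simp
  have "Cauchy x"
  proof (rule CauchyI')
    fix e :: real assume "0 < e"
    then obtain N where N: "\<And>m n. N \<le> m \<Longrightarrow> norm (sum ?d {m..<n}) < e"
      using assms unfolding summable_Cauchy by blast
    have "norm (x m - x n) < e" if "N \<le> m" "m < n" for m n
      using le[of m n] N[of m n] that by (simp add: norm_minus_commute)
    then show "\<exists>M. \<forall>m\<ge>M. \<forall>n>m. dist (x m) (x n) < e"
      by (auto simp: dist_norm)
  qed
  then show ?thesis by (simp add: Cauchy_convergent_iff)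
qed

section \<open>Functions of finitely many independent uniform indices\<close>

locale random_indices = prob_space M for M :: "'w measure" +
  fixes idx :: "nat \<Rightarrow> 'w \<Rightarrow> 'p::finite"
  assumes idx_indep: "indep_vars (\<lambda>_. count_space UNIV) idx UNIV"
    and idx_uniform: "\<And>k. distr M (count_space UNIV) (idx k) = uniform_count_measure UNIV"
begin

definition path :: "'w \<Rightarrow> nat \<Rightarrow> 'p" where
  "path w = (\<lambda>j. idx j w)"

text \<open>A function of the first \<open>k\<close> indices takes finitely many values, so it is measurable whatever
  its target space, and integrable if it is real valued.\<close>

definition depends_on :: "nat \<Rightarrow> ((nat \<Rightarrow> 'p) \<Rightarrow> 'b) \<Rightarrow> bool" where
  "depends_on k g \<longleftrightarrow> (\<forall>a b. (\<forall>j<k. a j = b j) \<longrightarrow> g a = g b)"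

lemma depends_onD: "depends_on k g \<Longrightarrow> (\<And>j. j < k \<Longrightarrow> a j = b j) \<Longrightarrow> g a = g b"
  by (auto simp: depends_on_def)

lemma depends_on_restrict: "depends_on k g \<Longrightarrow> g (restrict a {..<k}) = g a"
  by (rule depends_onD) auto

lemma idx_measurable [measurable]: "idx k \<in> measurable M (count_space UNIV)"
  using idx_indep by (auto simp: indep_vars_def)

text \<open>A finite product of counting spaces over a finite type is again a counting space, on
  which every function is measurable.\<close>

lemma measurable_from_indices:
  fixes k :: nat
  assumes "\<And>a. g a \<in> space N"
  shows "g \<in> measurable (PiM {..<k} (\<lambda>_. count_space (UNIV :: 'p set))) N"
  using assms by (subst count_space_PiM_finite) (auto simp: countable_finite)

lemma depends_on_measurable:
  fixes g :: "(nat \<Rightarrow> 'p) \<Rightarrow> 'b::topological_space"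
  assumes "depends_on k g"
  shows "(\<lambda>w. g (path w)) \<in> borel_measurable M"
proof -
  have X: "(\<lambda>w. restrict (\<lambda>j. idx j w) {..<k}) \<in> measurable M (PiM {..<k} (\<lambda>_. count_space UNIV))"
    by (rule measurable_restrict) (rule idx_measurable)
  have "g \<in> borel_measurable (PiM {..<k} (\<lambda>_. count_space UNIV))"
    by (rule measurable_from_indices) simp
  from measurable_compose[OF X this] show ?thesis
    unfolding depends_on_restrict[OF assms] path_def .
qed

lemma depends_on_bounded:
  fixes g :: "(nat \<Rightarrow> 'p) \<Rightarrow> real"
  assumes "depends_on k g"
  obtains B where "\<And>a. \<bar>g a\<bar> \<le> B"
proof -
  have "g a \<in> g ` PiE {..<k} (\<lambda>_. UNIV)" for a
    using depends_on_restrict[OF assms, of a] by (metis UNIV_I imageI restrict_PiE_iff)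
  then have "finite (range g)"
    by (intro finite_subset[of "range g" "g ` PiE {..<k} (\<lambda>_. UNIV)"] finite_imageI finite_PiE) auto
  then have "finite (range (\<lambda>a. \<bar>g a\<bar>))"
    using finite_imageI[of "range g" abs] by (simp add: image_image)
  then show ?thesis
    using that[of "Max (range (\<lambda>a. \<bar>g a\<bar>))"] by (auto intro: Max_ge)
qed

lemma depends_on_integrable:
  fixes g :: "(nat \<Rightarrow> 'p) \<Rightarrow> real"
  assumes "depends_on k g"
  shows "integrable M (\<lambda>w. g (path w))"
proof -
  obtain B where "\<And>a. \<bar>g a\<bar> \<le> B"
    using depends_on_bounded[OF assms] by metis
  then show ?thesis
    using depends_on_measurable[OF assms] by (intro integrable_const_bound[of _ B]) auto
qed

text \<open>The index blocks \<open>{k}\<close> and \<open>{..<k}\<close> are disjoint, so the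
  indicator and \<open>g\<close> are independent and the expectation factorizes. Uniformity gives
  the factor \<open>1 / CARD('p)\<close>.\<close>

lemma expectation_index:
  fixes g :: "(nat \<Rightarrow> 'p) \<Rightarrow> real"
  assumes "depends_on k g"
  shows "expectation (\<lambda>w. indicator {i} (path w k) * g (path w))
    = expectation (\<lambda>w. g (path w)) / CARD('p)"
proof -
  let ?N = "\<lambda>A. PiM A (\<lambda>_. count_space (UNIV :: 'p set))"
  let ?X = "\<lambda>A w. restrict (\<lambda>j. idx j w) A"
  have "indep_var (?N {k}) (?X {k}) (?N {..<k}) (?X {..<k})"
    using idx_indep by (rule indep_var_restrict) auto
  then have "indep_var borel ((\<lambda>f. indicator {i} (f k)) \<circ> ?X {k}) borel (g \<circ> ?X {..<k})"
    by (rule indep_var_compose) (auto intro!: measurable_from_indices)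
  then have ind: "indep_var borel (\<lambda>w. indicator {i} (idx k w) :: real) borel (\<lambda>w. g (path w))"
    using depends_on_restrict[OF assms] by (simp add: comp_def path_def)
  have int: "integrable M (\<lambda>w. indicator {i} (idx k w) :: real)"
    by (intro integrable_const_bound[of _ 1]) auto
  have "expectation (\<lambda>w. indicator {i} (idx k w))
      = integral\<^sup>L (distr M (count_space UNIV) (idx k)) (indicator {i} :: 'p \<Rightarrow> real)"
    by (subst integral_distr) auto
  also have "\<dots> = 1 / CARD('p)"
    unfolding idx_uniform by (simp add: measure_uniform_count_measure)
  finally show ?thesis
    using indep_var_lebesgue_integral[OF ind int depends_on_integrable[OF assms]]
    by (simp add: path_def)
qed

end

section \<open>Iterates as random variables, their energy and expected residuals\<close>

locale irsgd_random =
  irsgd_ball F F' yd u0 uhat oms lams \<omega> \<Omega> lmax \<rho> \<kappa> L \<eta> c + random_indices M idx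
  for F :: "'p::finite \<Rightarrow> 'u::{real_inner, complete_space} \<Rightarrow> 'y::real_inner"
    and F' yd u0 uhat oms lams \<omega> \<Omega> lmax \<rho> \<kappa> L \<eta> c
    and M :: "'w measure" and idx :: "nat \<Rightarrow> 'w \<Rightarrow> 'p" +
  assumes lams_summable: "summable lams"
    and F_continuous: "\<And>i. continuous_on (cball u0 (\<rho> + c)) (F i)"
begin

definition U :: "nat \<Rightarrow> 'w \<Rightarrow> 'u" where
  "U k w = iter (path w) k"

definition R :: "nat \<Rightarrow> real" where
  "R k = expectation (\<lambda>w. residual (U k w))"

text \<open>Two iterates are treated jointly since distances between them must be measurable, and
  this does not follow from their separate measurability in a non-separable space.\<close>

lemma depends_on_iter: "depends_on m (\<lambda>a. f (iter a p) (iter a q))" if "p \<le> m" "q \<le> m"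
proof (unfold depends_on_def, intro allI impI)
  fix a b :: "nat \<Rightarrow> 'p" assume "\<forall>j<m. a j = b j"
  then have "iter a p = iter b p" "iter a q = iter b q"
    using that by (auto intro!: iter_cong)
  then show "f (iter a p) (iter a q) = f (iter b p) (iter b q)" by simp
qed

lemma measurable_U2: "(\<lambda>w. f (U p w) (U q w)) \<in> borel_measurable M"
  for f :: "'u \<Rightarrow> 'u \<Rightarrow> 'b::topological_space"
  unfolding U_def by (rule depends_on_measurable[OF depends_on_iter[of _ "max p q"]]) auto

lemma integrable_U2 [simp]: "integrable M (\<lambda>w. f (U p w) (U q w))" for f :: "'u \<Rightarrow> 'u \<Rightarrow> real"
  unfolding U_def by (rule depends_on_integrable[OF depends_on_iter[of _ "max p q"]]) auto

lemma measurable_U: "U k \<in> borel_measurable M"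
  using measurable_U2[of "\<lambda>a b. a" k k] by simp

lemma integrable_U [simp]: "integrable M (\<lambda>w. f (U k w))" for f :: "'u \<Rightarrow> real"
  using integrable_U2[of "\<lambda>a b. f a" k k] by simp

lemma norm_U_le: "norm (U k w - uhat) \<le> c"
  unfolding U_def by (rule iter_in_cball)

lemma R_nonneg: "0 \<le> R k"
  by (simp add: R_def residual_nonneg)

text \<open>Splitting according to the value of the current index writes the one-component residual
  as a sum of indicators times functions of earlier indices. Each indicator then averages to
  \<open>1 / CARD('p)\<close>, which leaves the full residual.\<close>

lemma expectation_step_residual:
  shows "integrable M (\<lambda>w. (norm (F (path w k) (U k w) - yd $ path w k))\<^sup>2)"
    and "expectation (\<lambda>w. (norm (F (path w k) (U k w) - yd $ path w k))\<^sup>2) = R k / CARD('p)"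
proof -
  define g where "g i a = (norm (F i (iter a k) - yd $ i))\<^sup>2" for i a
  have dep: "depends_on k (g i)" for i
    unfolding g_def by (rule depends_on_iter[of k k k "\<lambda>x y. (norm (F i x - yd $ i))\<^sup>2"]) auto
  have eq: "(norm (F (path w k) (U k w) - yd $ path w k))\<^sup>2
      = (\<Sum>i\<in>UNIV. indicator {i} (path w k) * g i (path w))" for w
    by (simp add: g_def U_def indicator_def if_distrib[of "\<lambda>x. x * _"] cong: if_cong)
  \<comment> \<open>One index more than in \<open>dep\<close>, because the indicator reads the index
    with number \<open>k\<close>.\<close>
  have dep2: "depends_on (Suc k) (\<lambda>a. indicator {i} (a k) * g i a)" for i
    unfolding depends_on_def
  proof (intro allI impI)
    fix a b :: "nat \<Rightarrow> 'p" assume ab: "\<forall>j<Suc k. a j = b j"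
    then have "g i a = g i b" by (intro depends_onD[OF dep]) auto
    then show "indicator {i} (a k) * g i a = indicator {i} (b k) * g i b"
      using ab by simp
  qed
  note int = depends_on_integrable[OF dep2]
  show "integrable M (\<lambda>w. (norm (F (path w k) (U k w) - yd $ path w k))\<^sup>2)"
    unfolding eq by (intro Bochner_Integration.integrable_sum int)
  have "expectation (\<lambda>w. (norm (F (path w k) (U k w) - yd $ path w k))\<^sup>2)
      = (\<Sum>i\<in>UNIV. expectation (\<lambda>w. indicator {i} (path w k) * g i (path w)))"
    unfolding eq by (rule Bochner_Integration.integral_sum) (rule int)
  also have "\<dots> = (\<Sum>i\<in>UNIV. expectation (\<lambda>w. g i (path w)) / CARD('p))"
    by (simp only: expectation_index[OF dep])
  also have "\<dots> = (\<Sum>i\<in>UNIV. expectation (\<lambda>w. g i (path w))) / CARD('p)"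
    by (simp add: sum_divide_distrib)
  also have "(\<Sum>i\<in>UNIV. expectation (\<lambda>w. g i (path w))) = R k"
    unfolding R_def residual_def U_def g_def[symmetric]
    using depends_on_integrable[OF dep] by simp
  finally show "expectation (\<lambda>w. (norm (F (path w k) (U k w) - yd $ path w k))\<^sup>2) = R k / CARD('p)" .
qed

definition energy :: "nat \<Rightarrow> real" where
  "energy k = expectation (\<lambda>w. (norm (U k w - uhat))\<^sup>2)"

text \<open>Expectation of the pathwise estimate \<open>quasi_fejer\<close> at \<open>uhat\<close>.
  Telescoping it yields summable expected residuals, and dropping the residual yields convergence of
  the energy.\<close>

lemma energy_step: "energy (Suc k) + D2 * (R k / CARD('p)) \<le> energy k + C * lams k"
proof -
  note int = integrable_U[of "\<lambda>x. (norm (x - uhat))\<^sup>2"] expectation_step_residual(1)[of k]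
  have "energy (Suc k) + D2 * (R k / CARD('p))
      = expectation (\<lambda>w. (norm (U (Suc k) w - uhat))\<^sup>2
          + D2 * (norm (F (path w k) (U k w) - yd $ path w k))\<^sup>2)"
    using int by (simp add: energy_def expectation_step_residual(2))
  also have "\<dots> \<le> expectation (\<lambda>w. (norm (U k w - uhat))\<^sup>2 + C * lams k)"
  proof (intro integral_mono)
    fix w
    have "uhat \<in> cball u0 (\<rho> + c)"
      using uhat(1) constants by (simp add: dist_norm)
    then show "(norm (U (Suc k) w - uhat))\<^sup>2
          + D2 * (norm (F (path w k) (U k w) - yd $ path w k))\<^sup>2
        \<le> (norm (U k w - uhat))\<^sup>2 + C * lams k"
      unfolding U_def by (rule quasi_fejer) (rule uhat(2))
  qed (use int in simp_all)
  also have "\<dots> = energy k + C * lams k"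
    using int by (simp add: energy_def prob_space)
  finally show ?thesis .
qed

lemma D2_pos: "0 < D2"
  using descent by (simp add: D2_def)

lemma energy_nonneg: "0 \<le> energy k"
  by (simp add: energy_def)

lemma summable_R: "summable R"
proof -
  have "summable (\<lambda>k. D2 * (R k / CARD('p)))"
  proof (rule summable_quasi_decseq)
    show "summable (\<lambda>k. C * lams k)"
      by (intro summable_mult lams_summable)
    show "energy (Suc k) + D2 * (R k / CARD('p)) \<le> energy k + C * lams k" for k
      by (rule energy_step)
    show "0 \<le> D2 * (R k / CARD('p))" for k
      using D2_pos R_nonneg[of k] by simp
  qed (use energy_nonneg C_nonneg regs(1) in auto)
  then have "summable (\<lambda>k. (CARD('p) / D2) * (D2 * (R k / CARD('p))))"
    by (rule summable_mult)
  then show ?thesis using D2_pos by simp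
qed

lemma Cauchy_energy: "Cauchy energy"
proof -
  have "energy (Suc k) \<le> energy k + C * lams k" for k
    using energy_step[of k] R_nonneg[of k] D2_pos
      mult_nonneg_nonneg[of D2 "R k / CARD('p)"] zero_le_divide_iff[of "R k" "CARD('p)"] by linarith
  then have "convergent energy"
    by (rule convergent_quasi_decseq[OF summable_mult[OF lams_summable]])
      (use energy_nonneg C_nonneg regs(1) in auto)
  then show ?thesis by (rule convergent_Cauchy)
qed

section \<open>Cauchy property in mean square\<close>

definition drift :: "nat \<Rightarrow> real" where
  "drift k = 3 * \<Omega> * (1 + \<eta>) * R k + lams k * ((\<rho> + c) * c)"

lemma summable_drift: "summable drift"
  unfolding drift_def by (intro summable_add summable_mult summable_mult2 summable_R lams_summable)

text \<open>The difference of two iterates telescopes into increments, each bounded by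
  \<open>increment_inner_le\<close> at \<open>U l\<close>. Minimality of \<open>R l\<close> replaces
  the residual at \<open>l\<close>, which would otherwise be counted once per increment, by the one
  at \<open>j\<close>.\<close>

lemma expectation_inner_le:
  assumes "p \<le> q" and l: "\<And>j. p \<le> j \<Longrightarrow> j < q \<Longrightarrow> R l \<le> R j"
  shows "\<bar>expectation (\<lambda>w. inner (U q w - U p w) (U l w - uhat))\<bar> \<le> sum drift {p..<q}"
proof -
  \<comment> \<open>Three iterates occur here, so the dependence on finitely many indices is shown
    directly instead of through \<open>depends_on_iter\<close>.\<close>
  have dep: "depends_on (max l (Suc j))
      (\<lambda>a. inner (iter a (Suc j) - iter a j) (iter a l - uhat))" for j
    unfolding depends_on_def by (auto intro!: arg_cong2[of _ _ _ _ inner] arg_cong2[of _ _ _ _ minus] iter_cong)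
  have int: "integrable M (\<lambda>w. inner (U (Suc j) w - U j w) (U l w - uhat))" for j
    unfolding U_def by (rule depends_on_integrable[OF dep])
  have eq: "inner (U q w - U p w) (U l w - uhat)
      = (\<Sum>j=p..<q. inner (U (Suc j) w - U j w) (U l w - uhat))" for w
    using sum_Suc_diff'[OF \<open>p \<le> q\<close>, of "\<lambda>k. U k w"] by (simp flip: inner_sum_left)
  have "expectation (\<lambda>w. inner (U q w - U p w) (U l w - uhat))
      = expectation (\<lambda>w. \<Sum>j=p..<q. inner (U (Suc j) w - U j w) (U l w - uhat))"
    by (intro Bochner_Integration.integral_cong refl eq)
  also have "\<dots> = (\<Sum>j=p..<q. expectation (\<lambda>w. inner (U (Suc j) w - U j w) (U l w - uhat)))"
    by (rule Bochner_Integration.integral_sum) (rule int)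
  finally have "\<bar>expectation (\<lambda>w. inner (U q w - U p w) (U l w - uhat))\<bar>
      \<le> (\<Sum>j=p..<q. \<bar>expectation (\<lambda>w. inner (U (Suc j) w - U j w) (U l w - uhat))\<bar>)"
    by (simp only: sum_abs)
  also have "\<dots> \<le> sum drift {p..<q}"
  proof (rule sum_mono)
    fix j assume j: "j \<in> {p..<q}"
    have "\<bar>expectation (\<lambda>w. inner (U (Suc j) w - U j w) (U l w - uhat))\<bar>
        \<le> expectation (\<lambda>w. \<bar>inner (U (Suc j) w - U j w) (U l w - uhat)\<bar>)"
      by (rule integral_abs_bound)
    also have "\<dots> \<le> expectation (\<lambda>w. \<Omega> * (1 + \<eta>) * (5 / 2 * residual (U j w)
        + 1 / 2 * residual (U l w)) + lams j * ((\<rho> + c) * c))"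
    proof (rule integral_mono)
      show "integrable M (\<lambda>w. \<bar>inner (U (Suc j) w - U j w) (U l w - uhat)\<bar>)"
        by (intro integrable_abs int)
      show "integrable M (\<lambda>w. \<Omega> * (1 + \<eta>) * (5 / 2 * residual (U j w)
          + 1 / 2 * residual (U l w)) + lams j * ((\<rho> + c) * c))"
        by (rule integrable_U2)
      show "\<bar>inner (U (Suc j) w - U j w) (U l w - uhat)\<bar> \<le> \<Omega> * (1 + \<eta>)
          * (5 / 2 * residual (U j w) + 1 / 2 * residual (U l w)) + lams j * ((\<rho> + c) * c)" for w
        unfolding U_def by (intro increment_inner_le iter_in_cball)
    qed
    also have "\<dots> = \<Omega> * (1 + \<eta>) * (5 / 2 * R j + 1 / 2 * R l) + lams j * ((\<rho> + c) * c)"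
      by (simp add: R_def prob_space)
    \<comment> \<open>The minimality of \<open>R l\<close> merges the weights:
      \<open>5 / 2 + 1 / 2 = 3\<close>.\<close>
    also have "\<dots> \<le> \<Omega> * (1 + \<eta>) * (3 * R j) + lams j * ((\<rho> + c) * c)"
      using l[of j] j \<Omega>_pos constants by (intro add_right_mono mult_left_mono) auto
    also have "\<dots> = drift j"
      by (simp add: drift_def)
    finally show "\<bar>expectation (\<lambda>w. inner (U (Suc j) w - U j w) (U l w - uhat))\<bar> \<le> drift j" .
  qed
  finally show ?thesis .
qed

definition dist2 :: "nat \<Rightarrow> nat \<Rightarrow> real" where
  "dist2 p q = expectation (\<lambda>w. (norm (U p w - U q w))\<^sup>2)"

text \<open>Expansion of the square around \<open>uhat\<close>. The energies already form a Cauchy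
  sequence, so only the mixed term needs an estimate.\<close>

lemma dist2_eq:
  "dist2 p l = energy p - energy l - 2 * expectation (\<lambda>w. inner (U p w - U l w) (U l w - uhat))"
proof -
  have eq: "(norm (x - y))\<^sup>2 = (norm (x - uhat))\<^sup>2 - (norm (y - uhat))\<^sup>2
      - 2 * inner (x - y) (y - uhat)" for x y
    unfolding power2_norm_eq_inner by (simp add: inner_simps inner_commute)
  have "dist2 p l = expectation (\<lambda>w. (norm (U p w - uhat))\<^sup>2 - (norm (U l w - uhat))\<^sup>2
      - 2 * inner (U p w - U l w) (U l w - uhat))"
    unfolding dist2_def by (intro Bochner_Integration.integral_cong refl eq)
  also have "\<dots> = energy p - energy l - 2 * expectation (\<lambda>w. inner (U p w - U l w) (U l w - uhat))"
    unfolding energy_def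
    by (simp add: integrable_U2[of "\<lambda>x y. inner (x - y) (y - uhat)"]
        integrable_U[of "\<lambda>x. (norm (x - uhat))\<^sup>2"])
  finally show ?thesis .
qed

text \<open>Comparing both \<open>U p\<close> and \<open>U q\<close> with the iterate \<open>U l\<close> of smallest expected residual in between
  makes the mixed terms summable.\<close>

lemma dist2_le:
  assumes "p \<le> q"
  obtains l where "p \<le> l" "l \<le> q"
    "dist2 q p \<le> 2 * \<bar>energy q - energy l\<bar> + 2 * \<bar>energy p - energy l\<bar> + 4 * sum drift {p..<q}"
proof -
  obtain l where l: "l \<in> {p..q}" "\<And>j. j \<in> {p..q} \<Longrightarrow> R l \<le> R j"
    using ex_min_if_finite[of "R ` {p..q}"] assms
    by (metis (no_types, lifting) arg_min_if_finite(1) arg_min_least atLeastAtMost_iff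
        empty_iff finite_atLeastAtMost order_refl)
  have "\<bar>expectation (\<lambda>w. inner (U q w - U l w) (U l w - uhat))\<bar> \<le> sum drift {l..<q}"
    using l by (intro expectation_inner_le) auto
  then have 1: "dist2 q l \<le> \<bar>energy q - energy l\<bar> + 2 * sum drift {l..<q}"
    unfolding dist2_eq by linarith
  have "\<bar>expectation (\<lambda>w. inner (U l w - U p w) (U l w - uhat))\<bar> \<le> sum drift {p..<l}"
    using l by (intro expectation_inner_le) auto
  moreover have "expectation (\<lambda>w. inner (U p w - U l w) (U l w - uhat))
      = - expectation (\<lambda>w. inner (U l w - U p w) (U l w - uhat))"
    unfolding integral_minus[symmetric] by (intro Bochner_Integration.integral_cong)
      (auto simp: inner_diff_left)
  ultimately have 2: "dist2 p l \<le> \<bar>energy p - energy l\<bar> + 2 * sum drift {p..<l}"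
    unfolding dist2_eq by linarith
  have "dist2 q p \<le> expectation (\<lambda>w. 2 * (norm (U q w - U l w))\<^sup>2 + 2 * (norm (U p w - U l w))\<^sup>2)"
    unfolding dist2_def
  proof (intro integral_mono)
    fix w
    have "(norm (x - y))\<^sup>2 \<le> 2 * (norm x)\<^sup>2 + 2 * (norm y)\<^sup>2" for x y :: 'u
      using zero_le_power2[of "norm (x + y)"] unfolding power2_norm_eq_inner
      by (simp add: inner_simps inner_commute)
    from this[of "U q w - U l w" "U p w - U l w"]
    show "(norm (U q w - U p w))\<^sup>2 \<le> 2 * (norm (U q w - U l w))\<^sup>2 + 2 * (norm (U p w - U l w))\<^sup>2"
      by simp
  qed (auto intro!: integrable_U2[of "\<lambda>x y. (norm (x - y))\<^sup>2"])
  also have "\<dots> = 2 * dist2 q l + 2 * dist2 p l"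
    by (simp add: dist2_def integrable_U2[of "\<lambda>x y. (norm (x - y))\<^sup>2"])
  also have "\<dots> \<le> 2 * (\<bar>energy q - energy l\<bar> + 2 * sum drift {l..<q})
      + 2 * (\<bar>energy p - energy l\<bar> + 2 * sum drift {p..<l})"
    using 1 2 by (intro add_mono mult_left_mono) auto
  also have "\<dots> = 2 * \<bar>energy q - energy l\<bar> + 2 * \<bar>energy p - energy l\<bar>
      + 4 * (sum drift {p..<l} + sum drift {l..<q})"
    by simp
  also have "sum drift {p..<l} + sum drift {l..<q} = sum drift {p..<q}"
    using l by (simp add: sum.atLeastLessThan_concat)
  finally show ?thesis
    using l by (intro that[of l]) auto
qed

lemma dist2_Cauchy:
  assumes "0 < e"
  shows "\<exists>N. \<forall>p\<ge>N. \<forall>q\<ge>p. dist2 q p < e"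
proof -
  \<comment> \<open>The terms of \<open>dist2_le\<close> carry the weights 2, 2 and 4, so the share
    \<open>e / 8\<close> for each adds up to \<open>e\<close>.\<close>
  obtain N1 where N1: "\<And>m n. m \<ge> N1 \<Longrightarrow> n \<ge> N1 \<Longrightarrow> \<bar>energy m - energy n\<bar> < e / 8"
    using CauchyD[OF Cauchy_energy, of "e / 8"] assms by auto
  obtain N2 where N2: "\<And>m n. m \<ge> N2 \<Longrightarrow> norm (sum drift {m..<n}) < e / 8"
    using summable_drift assms unfolding summable_Cauchy by (meson divide_pos_pos zero_less_numeral)
  have "dist2 q p < e" if "max N1 N2 \<le> p" "p \<le> q" for p q
  proof -
    obtain l where "p \<le> l" "l \<le> q"
      "dist2 q p \<le> 2 * \<bar>energy q - energy l\<bar> + 2 * \<bar>energy p - energy l\<bar> + 4 * sum drift {p..<q}"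
      using dist2_le[OF \<open>p \<le> q\<close>] .
    moreover have "sum drift {p..<q} < e / 8"
      using N2[of p q] that by simp
    ultimately show ?thesis
      using N1[of q l] N1[of p l] that by auto
  qed
  then show ?thesis by blast
qed

section \<open>Almost sure convergence and the random limit\<close>

lemma AE_subsequence_convergent:
  "\<exists>n. strict_mono n \<and> (AE w in M. convergent (\<lambda>j. U (n j) w))"
proof -
  have "\<forall>j. \<exists>N. \<forall>p\<ge>N. \<forall>q\<ge>p. dist2 q p < (1 / 4) ^ j"
    by (intro allI dist2_Cauchy) simp
  then obtain N where N: "\<And>j p q. N j \<le> p \<Longrightarrow> p \<le> q \<Longrightarrow> dist2 q p < (1 / 4) ^ j"
    by metis
  \<comment> \<open>The sum makes \<open>n j\<close> at least \<open>N j\<close>; the summand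
    \<open>j\<close> makes the sequence strictly increasing.\<close>
  define n where "n j = (\<Sum>i\<le>j. N i) + j" for j
  have mono: "strict_mono n"
    by (rule strict_monoI_Suc) (simp add: n_def)
  have "N j \<le> n j" for j
    unfolding n_def by (rule trans_le_add1, rule member_le_sum) auto
  then have small: "dist2 (n (Suc j)) (n j) \<le> (1 / 4) ^ j" for j
    using N[of j "n j" "n (Suc j)"] strict_mono_less_eq[OF mono] by (simp add: less_imp_le)
  have int: "integrable M (\<lambda>w. norm (U (n (Suc j)) w - U (n j) w))" for j
    by (rule integrable_U2)
  \<comment> \<open>The first moment is bounded by the second through
    \<open>d \<le> (s * d\<^sup>2 + 1 / s) / 2\<close> with \<open>s = 2 ^ j\<close>, the weight
    that balances the rate \<open>(1 / 4) ^ j\<close> and leaves a geometric series.\<close>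
  have "expectation (\<lambda>w. norm (U (n (Suc j)) w - U (n j) w)) \<le> (1 / 2) ^ j" for j
  proof -
    have "expectation (\<lambda>w. norm (U (n (Suc j)) w - U (n j) w))
        \<le> expectation (\<lambda>w. (2 ^ j * (norm (U (n (Suc j)) w - U (n j) w))\<^sup>2 + (1 / 2) ^ j) / 2)"
    proof (intro integral_mono int)
      fix w
      define d where "d = norm (U (n (Suc j)) w - U (n j) w)"
      define s :: real where "s = 2 ^ j"
      have "0 < s" by (simp add: s_def)
      have "0 \<le> (s * d - 1)\<^sup>2 / (2 * s)"
        using \<open>0 < s\<close> by simp
      also have "\<dots> = (s * d\<^sup>2 + 1 / s) / 2 - d"
        using \<open>0 < s\<close> by (simp add: field_simps power2_eq_square)
      finally show "d \<le> (2 ^ j * d\<^sup>2 + (1 / 2) ^ j) / 2"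
        by (simp add: s_def power_one_over)
    qed (rule integrable_U2[of "\<lambda>x y. (_ * (norm (x - y))\<^sup>2 + _) / _"])
    also have "\<dots> = (2 ^ j * dist2 (n (Suc j)) (n j) + (1 / 2) ^ j) / 2"
      by (simp add: dist2_def integrable_U2[of "\<lambda>x y. (norm (x - y))\<^sup>2"] prob_space)
    also have "\<dots> \<le> (2 ^ j * (1 / 4) ^ j + (1 / 2) ^ j) / 2"
      using small[of j] by simp
    also have "\<dots> = (1 / 2) ^ j"
      by (simp flip: power_mult_distrib)
    finally show ?thesis .
  qed
  then have "summable (\<lambda>j. expectation (\<lambda>w. norm (U (n (Suc j)) w - U (n j) w)))"
    by (intro summable_comparison_test_ev[OF always_eventually summable_geometric[of "1 / 2"]]) auto
  then have "AE w in M. summable (\<lambda>j. norm (U (n (Suc j)) w - U (n j) w))"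
    by (rule AE_summable_of_summable_integral[OF int, rotated]) auto
  then have "AE w in M. convergent (\<lambda>j. U (n j) w)"
    by eventually_elim (rule convergent_of_summable_increments)
  then show ?thesis using mono by blast
qed

lemma AE_convergent:
  "AE w in M. \<exists>v \<in> cball uhat c. (\<forall>i. F i v = yd $ i) \<and> (\<lambda>k. U k w) \<longlonglongrightarrow> v"
proof -
  obtain n where n: "strict_mono n" "AE w in M. convergent (\<lambda>j. U (n j) w)"
    using AE_subsequence_convergent by blast
  have "AE w in M. summable (\<lambda>k. residual (U k w))"
    using summable_R unfolding R_def
    by (rule AE_summable_of_summable_integral[OF integrable_U residual_nonneg])
  with n(2) show ?thesis
  proof eventually_elim
    fix w
    assume "convergent (\<lambda>j. U (n j) w)" and res: "summable (\<lambda>k. residual (U k w))"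
    then obtain v where v: "(\<lambda>j. U (n j) w) \<longlonglongrightarrow> v"
      by (auto simp: convergent_def)
    have v_in: "v \<in> cball uhat c"
      using v by (rule closed_sequentially[OF closed_cball, rotated])
        (use norm_U_le in \<open>auto simp: dist_norm norm_minus_commute\<close>)
    then have v_dom: "v \<in> cball u0 (\<rho> + c)"
      using cball_uhat_subset by blast
    have sol: "F i v = yd $ i" for i
    proof -
      have "(\<lambda>k. residual (U k w)) \<longlonglongrightarrow> 0"
        using res by (rule summable_LIMSEQ_zero)
      then have "(\<lambda>k. (norm (F i (U k w) - yd $ i))\<^sup>2) \<longlonglongrightarrow> 0"
        by (rule real_tendsto_sandwich[OF _ _ tendsto_const, rotated 2])
          (auto intro!: always_eventually component_le_residual)
      then have "(\<lambda>k. F i (U k w) - yd $ i) \<longlonglongrightarrow> 0"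
        using tendsto_real_sqrt by (fastforce simp: tendsto_norm_zero_iff)
      then have "(\<lambda>j. F i (U (n j) w)) \<longlonglongrightarrow> yd $ i"
        using n(1) LIMSEQ_subseq_LIMSEQ[of "\<lambda>k. F i (U k w)" "yd $ i" n]
        by (simp add: LIM_zero_iff comp_def)
      moreover have "(\<lambda>j. F i (U (n j) w)) \<longlonglongrightarrow> F i v"
        using iter_in_domain
        by (intro continuous_on_tendsto_compose[OF F_continuous v v_dom])
          (auto simp: U_def simp del: mem_cball)
      ultimately show ?thesis
        by (rule LIMSEQ_unique[symmetric])
    qed
    \<comment> \<open>The point \<open>v\<close> depends on \<open>w\<close>, but
      \<open>quasi_fejer\<close> holds along each single path and may be applied to it. The
      distances to \<open>v\<close> thus converge, and the subsequence forces their limit to be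
      0.\<close>
    have "convergent (\<lambda>k. (norm (U k w - v))\<^sup>2)"
    proof (rule convergent_quasi_decseq)
      show "summable (\<lambda>k. C * lams k)"
        by (intro summable_mult lams_summable)
      fix k
      have "0 \<le> D2 * (norm (F (path w k) (U k w) - yd $ path w k))\<^sup>2"
        using D2_pos by simp
      then show "(norm (U (Suc k) w - v))\<^sup>2 \<le> (norm (U k w - v))\<^sup>2 + C * lams k"
        using quasi_fejer[OF v_dom sol, of "path w" k] unfolding U_def by linarith
    qed (use C_nonneg regs(1) in auto)
    then obtain t where t: "(\<lambda>k. (norm (U k w - v))\<^sup>2) \<longlonglongrightarrow> t"
      by (auto simp: convergent_def)
    have "(\<lambda>j. (norm (U (n j) w - v))\<^sup>2) \<longlonglongrightarrow> (norm (v - v))\<^sup>2"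
      by (intro tendsto_intros v)
    moreover have "(\<lambda>j. (norm (U (n j) w - v))\<^sup>2) \<longlonglongrightarrow> t"
      using LIMSEQ_subseq_LIMSEQ[OF t n(1)] by (simp add: comp_def)
    ultimately have "(norm (v - v))\<^sup>2 = t"
      by (rule LIMSEQ_unique)
    then have "(\<lambda>k. norm (U k w - v)) \<longlonglongrightarrow> 0"
      using tendsto_real_sqrt[OF t] by simp
    then have "(\<lambda>k. U k w) \<longlonglongrightarrow> v"
      by (simp add: tendsto_norm_zero_iff LIM_zero_iff)
    then show "\<exists>v \<in> cball uhat c. (\<forall>i. F i v = yd $ i) \<and> (\<lambda>k. U k w) \<longlonglongrightarrow> v"
      using v_in sol by blast
  qed
qed

text \<open>The pointwise limits are assembled into one measurable function by altering the iterates
  on a null set. The mean square limit then follows by dominated convergence, as all iterates lie in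
  one ball.\<close>

lemma convergence:
  "\<exists>ud \<in> borel_measurable M.
     (AE w in M. (\<lambda>k. U k w) \<longlonglongrightarrow> ud w) \<and>
     (\<forall>k. integrable M (\<lambda>w. (norm (U k w - ud w))\<^sup>2)) \<and>
     (\<lambda>k. expectation (\<lambda>w. (norm (U k w - ud w))\<^sup>2)) \<longlonglongrightarrow> 0 \<and>
     (AE w in M. ud w \<in> cball uhat c \<and> (\<forall>i. F i (ud w) = yd $ i))"
proof -
  obtain E where E: "E \<in> null_sets M"
    and conv: "\<And>w. w \<in> space M - E \<Longrightarrow>
      \<exists>v \<in> cball uhat c. (\<forall>i. F i v = yd $ i) \<and> (\<lambda>k. U k w) \<longlonglongrightarrow> v"
    using AE_convergent by (rule AE_E3) blast
  \<comment> \<open>On the exceptional set the sequence is constant with value \<open>uhat\<close>,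
    itself a solution in the ball. So the limit exists and has the required properties at every
    point of the space.\<close>
  define V where "V k w = (if w \<in> E then uhat else U k w)" for k w
  define ud where "ud w = lim (\<lambda>k. V k w)" for w
  have E_sets [measurable]: "E \<in> sets M" using E by auto
  have good: "ud w \<in> cball uhat c \<and> (\<forall>i. F i (ud w) = yd $ i) \<and> (\<lambda>k. V k w) \<longlonglongrightarrow> ud w"
    if w: "w \<in> space M" for w
  proof (cases "w \<in> E")
    case True
    then show ?thesis
      using uhat(2) constants by (simp add: ud_def V_def)
  next
    case False
    then obtain v where "v \<in> cball uhat c" "\<forall>i. F i v = yd $ i" "(\<lambda>k. U k w) \<longlonglongrightarrow> v"
      using conv[of w] w by auto
    then show ?thesis
      using False by (simp add: ud_def V_def limI)
  qed
  have V_meas: "V k \<in> borel_measurable M" for k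
    unfolding V_def using measurable_U by measurable
  have ud: "ud \<in> borel_measurable M"
  proof (rule borel_measurable_LIMSEQ_metric)
    show "V k \<in> borel_measurable M" for k by (rule V_meas)
    show "(\<lambda>k. V k w) \<longlonglongrightarrow> ud w" if "w \<in> space M" for w
      using good[OF that] by blast
  qed
  have lim: "(\<lambda>k. U k w) \<longlonglongrightarrow> ud w" if "w \<in> space M - E" for w
    using good[of w] that by (simp add: V_def)
  have AE_E: "AE w in M. w \<in> space M - E"
    using AE_not_in[OF E] AE_space by eventually_elim simp
  text \<open>Subtraction need not be measurable on a non-separable space, so the distance to the limit
    is obtained as a limit of functions with finitely many values.\<close>
  have meas: "(\<lambda>w. (norm (U k w - ud w))\<^sup>2) \<in> borel_measurable M" for k
  proof (rule borel_measurable_LIMSEQ_metric)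
    have "(\<lambda>w. if w \<in> E then (norm (U k w - uhat))\<^sup>2 else (norm (U k w - U m w))\<^sup>2)
        \<in> borel_measurable M" for m
      using measurable_U2[of "\<lambda>x y. (norm (x - y))\<^sup>2" k m] measurable_U2[of "\<lambda>x y. (norm (x - uhat))\<^sup>2" k k]
      by measurable
    then show "(\<lambda>w. (norm (U k w - V m w))\<^sup>2) \<in> borel_measurable M" for m
      by (rule back_subst[of "\<lambda>f. f \<in> borel_measurable M"]) (auto simp: V_def fun_eq_iff)
    show "(\<lambda>m. (norm (U k w - V m w))\<^sup>2) \<longlonglongrightarrow> (norm (U k w - ud w))\<^sup>2" if "w \<in> space M" for w
      using good[OF that] by (intro tendsto_intros) auto
  qed
  \<comment> \<open>Iterate and limit both lie in the ball of radius \<open>c\<close> around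
    \<open>uhat\<close>; its squared diameter serves as the integrable majorant.\<close>
  have bound: "(norm (U k w - ud w))\<^sup>2 \<le> (2 * c)\<^sup>2" if "w \<in> space M" for k w
  proof (rule power_mono)
    show "norm (U k w - ud w) \<le> 2 * c"
      using norm_U_le[of k w] good[OF that] norm_triangle_ineq4[of "U k w - uhat" "ud w - uhat"]
      by (simp add: dist_norm norm_minus_commute)
  qed simp
  have int: "integrable M (\<lambda>w. (norm (U k w - ud w))\<^sup>2)" for k
    using bound meas by (intro integrable_const_bound[of _ "(2 * c)\<^sup>2"]) (auto intro!: AE_I2)
  have "(\<lambda>k. expectation (\<lambda>w. (norm (U k w - ud w))\<^sup>2)) \<longlonglongrightarrow> expectation (\<lambda>w. 0)"
  proof (rule integral_dominated_convergence[where w = "\<lambda>_. (2 * c)\<^sup>2"])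
    show "AE w in M. (\<lambda>k. (norm (U k w - ud w))\<^sup>2) \<longlonglongrightarrow> 0"
      using AE_E
    proof eventually_elim
      fix w assume "w \<in> space M - E"
      from lim[OF this] have "(\<lambda>k. (norm (U k w - ud w))\<^sup>2) \<longlonglongrightarrow> (norm (ud w - ud w))\<^sup>2"
        by (intro tendsto_intros)
      then show "(\<lambda>k. (norm (U k w - ud w))\<^sup>2) \<longlonglongrightarrow> 0" by simp
    qed
  qed (use meas bound in \<open>auto intro!: AE_I2\<close>)
  moreover have "AE w in M. (\<lambda>k. U k w) \<longlonglongrightarrow> ud w"
    using AE_E by eventually_elim (rule lim)
  moreover have "AE w in M. ud w \<in> cball uhat c \<and> (\<forall>i. F i (ud w) = yd $ i)"
    using good by (intro AE_I2) blast
  ultimately show ?thesis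
    using ud int by (intro bexI[of _ ud]) auto
qed

end

section \<open>Convergence of the iteration with \<open>c_const\<close> as radius\<close>

theorem theorem3p1:
  fixes F :: "'p::finite \<Rightarrow> 'u::{real_inner, complete_space} \<Rightarrow> 'y::{real_inner, complete_space}"
    and F' :: "'p \<Rightarrow> 'u \<Rightarrow> ('u \<Rightarrow>\<^sub>L 'y)"
    and D :: "'p \<Rightarrow> 'u set"
    and Y :: "'p \<Rightarrow> 'y set"
    and yd :: "'y ^ 'p"
    and u0 uhat :: 'u
    and oms lams :: "nat \<Rightarrow> real"
    and \<omega> \<Omega> lmax lsum \<rho> vrho \<kappa> \<tau> L \<eta> c M :: real
    and Pr :: "'w measure"
    and idx :: "nat \<Rightarrow> 'w \<Rightarrow> 'p"
    and u :: "nat \<Rightarrow> 'w \<Rightarrow> 'u"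
  defines "c \<equiv> c_const lmax vrho \<kappa> \<Omega> L \<rho>"
    and "M \<equiv> M_const lmax vrho \<kappa> \<Omega> L \<rho> \<tau> \<eta>"
    and "u \<equiv> (\<lambda>k w. irsgd F F' yd oms lams u0 (\<lambda>j. idx j w) k)"
  \<comment> \<open>setting\<close>
  assumes Y_hilbert: "\<And>i. subspace (Y i)" "\<And>i. closed (Y i)"
    and F_range: "\<And>i v. v \<in> D i \<Longrightarrow> F i v \<in> Y i"
    and yd_range: "\<And>i. yd $ i \<in> Y i"
    and F_deriv: "\<And>i v. v \<in> D i \<Longrightarrow> (F i has_derivative blinfun_apply (F' i v)) (at v within D i)"
  \<comment> \<open>step sizes, regularization parameters and random indices\<close>
    and steps: "0 < \<omega>" "\<And>k. \<omega> \<le> oms k" "\<And>k. oms k \<le> \<Omega>"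
    and regs: "\<And>k. 0 \<le> lams k" "\<And>k. lams k \<le> lmax" "lmax < 1 / 2"
    and prob: "prob_space Pr"
    and idx_indep: "prob_space.indep_vars Pr (\<lambda>_. count_space UNIV) idx UNIV"
    and idx_uniform: "\<And>k. distr Pr (count_space UNIV) (idx k) = uniform_count_measure UNIV"
  \<comment> \<open>constants\<close>
    and params: "0 < \<rho>" "0 < \<kappa>" "\<kappa> < 1" "1 < \<tau>" "0 < vrho" "(1 - lmax)\<^sup>2 < 1 / (1 + vrho)"
  \<comment> \<open>Assumption A\<close>
    and F_cont: "continuous_on (\<Inter>i. D i) (joint_op F)"
    and ball_dom: "\<And>i. cball u0 (\<rho> + c) \<subseteq> D i"
    and L_bounds: "0 < L" "L \<le> 1 / (2 * \<omega>)"
    and deriv_bound: "\<And>i v. v \<in> cball u0 (\<rho> + c) \<Longrightarrow> norm (F' i v) \<le> L"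
    and \<eta>_bounds: "0 < \<eta>" "\<eta> < 1"
    and tangential_cone: "\<And>i v v'. v \<in> cball u0 (\<rho> + c) \<Longrightarrow> v' \<in> cball u0 (\<rho> + c) \<Longrightarrow>
           norm (F i v' - F i v - blinfun_apply (F' i v) (v' - v)) \<le> \<eta> * norm (F i v' - F i v)"
    and uhat_solution: "uhat \<in> solution_set D F yd \<rho> u0"
  \<comment> \<open>hypotheses of the theorem\<close>
    and D1_pos: "2 * \<omega> * (1 - lmax) * (1 - \<eta>) - \<Omega>\<^sup>2 * L\<^sup>2 - \<kappa>\<^sup>2
                   - inverse \<tau> * \<Omega> * (2 + M) * (1 + \<eta>) > 0"
    and lam_sum: "summable lams" "(\<Sum>k. lams k) \<le> lsum"
    and D2_pos: "2 * \<omega> * (1 - lmax) * (1 - \<eta>) - \<Omega>\<^sup>2 * L\<^sup>2 - \<kappa>\<^sup>2 > 0"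
  shows "\<exists>ud \<in> borel_measurable Pr.
           (AE w in Pr. (\<lambda>k. u k w) \<longlonglongrightarrow> ud w) \<and>
           (\<forall>k. integrable Pr (\<lambda>w. (norm (u k w - ud w))\<^sup>2)) \<and>
           (\<lambda>k. prob_space.expectation Pr (\<lambda>w. (norm (u k w - ud w))\<^sup>2)) \<longlonglongrightarrow> 0 \<and>
           (AE w in Pr. ud w \<in> solution_set D F yd c uhat)"
proof -
  have lmax: "0 \<le> lmax"
    using regs(1)[of 0] regs(2)[of 0] by linarith
  note c_props = c_const_properties[OF lmax regs(3) params(1,2,5,6), of \<Omega> L, folded c_def]
  have uhat: "norm (u0 - uhat) \<le> \<rho>" "\<And>i. F i uhat = yd $ i"
    using uhat_solution by (auto simp: solution_set_def joint_op_def dist_norm)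
  \<comment> \<open>Each component is continuous on the ball because it is differentiable within its
    domain, which contains the ball.\<close>
  have "continuous_on (cball u0 (\<rho> + c)) (F i)" for i
  proof -
    have "continuous_on (D i) (F i)"
      unfolding continuous_on_eq_continuous_within
      by (intro ballI) (rule has_derivative_continuous[OF F_deriv])
    then show ?thesis
      using ball_dom by (rule continuous_on_subset)
  qed
  then interpret irsgd_random F F' yd u0 uhat oms lams \<omega> \<Omega> lmax \<rho> \<kappa> L \<eta> c Pr idx
    using steps regs params L_bounds \<eta>_bounds c_props D2_pos deriv_bound tangential_cone uhat
      prob idx_indep idx_uniform lam_sum(1)
    by (intro irsgd_random.intro irsgd_ball.intro random_indices.intro random_indices_axioms.intro
        irsgd_random_axioms.intro) auto
  have u: "u k w = U k w" for k w
    by (simp add: u_def U_def iter_def path_def)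
  \<comment> \<open>Membership in all domains is added here: the ball of radius \<open>c\<close>
    around \<open>uhat\<close> lies in the ball around \<open>u0\<close>, and that ball is contained
    in every \<open>D i\<close>.\<close>
  have solution: "v \<in> solution_set D F yd c uhat"
    if v: "v \<in> cball uhat c \<and> (\<forall>i. F i v = yd $ i)" for v
  proof -
    have "v \<in> D i" for i
      using v cball_uhat_subset ball_dom[of i] by blast
    then show ?thesis
      using v by (simp add: solution_set_def joint_op_def vec_eq_iff)
  qed
  obtain ud where ud: "ud \<in> borel_measurable Pr" "AE w in Pr. (\<lambda>k. U k w) \<longlonglongrightarrow> ud w"
    "\<forall>k. integrable Pr (\<lambda>w. (norm (U k w - ud w))\<^sup>2)"
    "(\<lambda>k. expectation (\<lambda>w. (norm (U k w - ud w))\<^sup>2)) \<longlonglongrightarrow> 0"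
    "AE w in Pr. ud w \<in> cball uhat c \<and> (\<forall>i. F i (ud w) = yd $ i)"
    using convergence by blast
  have "AE w in Pr. ud w \<in> solution_set D F yd c uhat"
    using ud(5) by (rule eventually_mono) (rule solution)
  then show ?thesis
    unfolding u using ud(1-4) by (intro bexI[of _ ud] conjI)
qed

end
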